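(* Let $p\in(0,1)$, let $\mu(db)=f(b)\,db$ be a probability measure on $[0,1]$, and let $\mu^\varepsilon=\varepsilon\sum_{b\in B^\varepsilon}\delta_b$ be the empirical measure of $\varepsilon^{-1}$ i.i.d. bids with law $\mu$. Let $(q^\varepsilon_t)_{t\ge0}$ be the max-price evolution for $\mu^\varepsilon$ and $(q_t)_{t\ge0}$ the max-price evolution for $\mu$. Then, for every fixed $t\ge0$, $$\lim_{\varepsilon\to0}q^\varepsilon_t=q_t\qquad\text{almost surely}.$$
   Context: Here $\varepsilon=1/n$ with $n$ a positive integer, and $B^\varepsilon=\{b_1,\dots,b_{1/\varepsilon}\}$ where $b_1,b_2,\dots$ are i.i.d. with law $\mu$. For a probability measure $\nu$ on $[0,1]$ with cumulative function $F_\nu(x)=\nu([0,x])$ (equal to $0$ for $x<0$ and $1$ for $x>1$), the max-price evolution for $\nu$ is the solution $(q_t)_{t\ge0}$ of $$\frac{dq_t}{dt}=u_t\,\mathbf{1}\{q_t\in(0,1)\},\quad u_t=\frac{w_t-\ell_t}{w_t+\ell_t},\quad w_t=p-F_\nu((q_t-t)^-),\quad \ell_t=F_\nu(q_t+t)-p,$$ with $q_0=F_\nu^{-1}(p)=\inf\{x\ge0:F_\nu(x)\ge p\}$. Explicitly, if $x_t$ is the unique $x\in[q_0-t,q_0+t]$ with $\int_{x-t}^{x+t}F_\nu(z)\,dz=2pt$, then $q_t=x_t$ if $x_t\in(0,1)$, $q_t=1$ if $x_t\ge1$, $q_t=0$ if $x_t\le0$.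
   Formalization: Added hypothesis: F_μ(x) > p for every x > q_0 + 2t (any flat piece of F_μ at height p has length at most 2t); without it the limit fails, e.g. f = 2 on [0,1/4]∪[3/4,1], p = 1/2, t = 0. Also u_t is read as 1 when w_t = ℓ_t = 0, and the ODE in integrated form. *)

theory Defs
  imports "HOL-Probability.Probability"
begin

text \<open>
  Measures are Borel measures on the real line. For a probability measure \<open>\<nu>\<close> carried by \<open>[0,1]\<close>,
  \<open>cdf \<nu> x = \<nu> {..x}\<close> is \<open>\<nu>([0,x])\<close> for \<open>x \<in> [0,1]\<close>, is \<open>0\<close> for \<open>x < 0\<close> and \<open>1\<close> for \<open>x > 1\<close>.
\<close>

definition cdf_left :: "real measure \<Rightarrow> real \<Rightarrow> real" where
  "cdf_left \<nu> x = Lim (at_left x) (cdf \<nu>)"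

definition quantile :: "real measure \<Rightarrow> real \<Rightarrow> real" where
  "quantile \<nu> p = Inf {x. 0 \<le> x \<and> p \<le> cdf \<nu> x}"

text \<open>
  The slope \<open>u\<close> at time \<open>t\<close> and position \<open>x\<close>. The quotient is undefined for \<open>w = l = 0\<close>. Along a
  solution inside \<open>(0,1)\<close> this happens, apart from \<open>t = 0\<close>, only if the cdf has no atom at the
  quantile \<open>q\<^sub>0\<close>, is constantly \<open>p\<close> on \<open>[q\<^sub>0, q\<^sub>0 + 2 t]\<close>, and \<open>x = q\<^sub>0 + t\<close>. There the explicit
  solution, the \<open>x \<in> [q\<^sub>0 - t, q\<^sub>0 + t]\<close> at which the cdf integrates to \<open>2 p t\<close> over
  \<open>[x - t, x + t]\<close>, is \<open>q\<^sub>0 + t\<close>, so the slope is \<open>1\<close>.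
\<close>

definition max_price_slope :: "real \<Rightarrow> real measure \<Rightarrow> real \<Rightarrow> real \<Rightarrow> real" where
  "max_price_slope p \<nu> t x =
     (let w = p - cdf_left \<nu> (x - t);
          l = cdf \<nu> (x + t) - p
      in if w = 0 \<and> l = 0 then 1 else (w - l) / (w + l))"

text \<open>
  If \<open>\<nu>\<close> has atoms then the slope jumps in time and the solution has kinks, so the differential
  equation is understood in the sense of Caratheodory, that is, in integrated form.
\<close>

definition solves_max_price_ode :: "real \<Rightarrow> real measure \<Rightarrow> (real \<Rightarrow> real) \<Rightarrow> bool" where
  "solves_max_price_ode p \<nu> q \<longleftrightarrow>
     q 0 = quantile \<nu> p \<and>
     (\<forall>t\<ge>0. ((\<lambda>s. max_price_slope p \<nu> s (q s) * indicator {0<..<1} (q s))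
               has_integral (q t - q 0)) {0..t})"

text \<open>
  The solution is unique as a function on \<open>{0..}\<close> when it starts in \<open>(0,1)\<close>; extensionality only
  fixes its irrelevant values at negative times.
\<close>

definition max_price_evolution :: "real \<Rightarrow> real measure \<Rightarrow> real \<Rightarrow> real" where
  "max_price_evolution p \<nu> = (THE q. q \<in> extensional {0..} \<and> solves_max_price_ode p \<nu> q)"

definition empirical_measure :: "nat \<Rightarrow> (nat \<Rightarrow> real) \<Rightarrow> real measure" where
  "empirical_measure n x =
     measure_of UNIV (sets borel)
       (\<lambda>A. ennreal (1 / real n) * (\<Sum>i\<in>{1..n}. emeasure (return borel (x i)) A))"

lemma space_empirical_measure [simp]: "space (empirical_measure n x) = UNIV"
  by (simp add: empirical_measure_def)

lemma sets_empirical_measure [simp, measurable_cong]: "sets (empirical_measure n x) = sets borel"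
  using sets.sigma_sets_eq[of "borel :: real measure"] by (simp add: empirical_measure_def)

lemma emeasure_empirical_measure:
  assumes "A \<in> sets borel"
  shows "emeasure (empirical_measure n x) A =
    ennreal (1 / real n) * (\<Sum>i\<in>{1..n}. emeasure (return borel (x i)) A)"
proof (rule emeasure_measure_of[OF empirical_measure_def])
  show "A \<in> sets (empirical_measure n x)" using assms by simp
  show "countably_additive (sets (empirical_measure n x))
    (\<lambda>A. ennreal (1 / real n) * (\<Sum>i\<in>{1..n}. emeasure (return borel (x i)) A))"
  proof (rule countably_additiveI)
    fix B :: "nat \<Rightarrow> real set"
    assume B: "range B \<subseteq> sets (empirical_measure n x)" "disjoint_family B"
    have eq: "emeasure (return borel (x i)) (\<Union>k. B k) = (\<Sum>k. emeasure (return borel (x i)) (B k))" for i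
      using B by (intro suminf_emeasure[symmetric]) auto
    show "(\<Sum>k. ennreal (1 / real n) * (\<Sum>i\<in>{1..n}. emeasure (return borel (x i)) (B k))) =
      ennreal (1 / real n) * (\<Sum>i\<in>{1..n}. emeasure (return borel (x i)) (\<Union>k. B k))"
      unfolding eq by (subst suminf_sum[symmetric]) auto
  qed
qed (auto simp: positive_def)

end

theory Submission imports Defs begin

text \<open>
  The excess \<open>excess x = \<integral> max 0 (x - b) d\<nu>(b) - p x\<close> is convex with one-sided slopes \<open>F(x\<^sup>-) - p\<close> and
  \<open>F(x) - p\<close>, strictly decreasing to the left of the quantile \<open>q0\<close> and nondecreasing to its right. So
  the solution without absorption is the point \<open>x\<close> with \<open>\<bar>x - q0\<bar> \<le> t\<close> and
  \<open>excess (x + t) = excess (x - t)\<close>. If \<open>\<nu>\<close> has finitely many atoms, it has the required slope off a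
  finite set of times, and by convexity it never returns to \<open>(0,1)\<close> once it has left, so its truncation
  to \<open>[0,1]\<close> solves the equation. Solutions are unique because they stay within \<open>\<bar>x - q0\<bar> \<le> t\<close>,
  where the slope is nonincreasing in \<open>x\<close>, and because they are absorbed at \<open>0\<close> and \<open>1\<close>.

  The function \<open>excess (y + t) - excess (y - t)\<close> is nondecreasing in \<open>y\<close> and, for \<open>\<mu>\<close>, changes sign
  strictly at the solution by the hypothesis on the level \<open>p\<close>. It is the mean of a bounded function
  of the bids, so the strong law of large numbers at rational \<open>y\<close> forces convergence of the
  solutions. The strong law for bounded variables follows from Hoeffding's inequality and
  Borel-Cantelli.
\<close>

text \<open>The largest point of the compact set where \<open>f\<close> is nonpositive is the
  required zero. This drives the barrier arguments below: past that point the sign of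
  \<open>f\<close> is known, and a bound on slopes there rules out the positive end value.\<close>

lemma last_crossing:
  fixes f :: "real \<Rightarrow> real"
  assumes cont: "continuous_on {a..b} f" and ab: "a \<le> b" "f a \<le> 0" "0 < f b"
  shows "\<exists>s\<ge>a. s < b \<and> f s = 0 \<and> (\<forall>r. s < r \<longrightarrow> r \<le> b \<longrightarrow> 0 < f r)"
proof -
  define S where "S = {a..b} \<inter> f -` {..0}"
  have "closed S"
    unfolding S_def by (rule continuous_closed_preimage[OF cont closed_atLeastAtMost closed_atMost])
  moreover have "S \<subseteq> {a..b}" by (simp add: S_def)
  ultimately have "compact S"
    using bounded_subset[OF bounded_closed_interval] compact_eq_bounded_closed by metis
  moreover have "a \<in> S" using ab by (simp add: S_def)
  ultimately obtain s where s: "s \<in> S" "\<And>r. r \<in> S \<Longrightarrow> r \<le> s"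
    using compact_attains_sup[of S] by auto
  have sb: "a \<le> s" "s \<le> b" "f s \<le> 0"
    using s(1) by (simp_all add: S_def)
  then have "s < b" using ab(3) by (cases "s = b") simp_all
  note sb = sb(1) this sb(3)
  have pos: "0 < f r" if "s < r" "r \<le> b" for r
  proof (rule ccontr)
    assume "\<not> 0 < f r"
    then have "r \<in> S" using that sb by (simp add: S_def)
    then show False using s(2) that by force
  qed
  have "f s = 0"
  proof (rule ccontr)
    assume "f s \<noteq> 0"
    then have "f s < 0" using sb by simp
    have "\<exists>r\<ge>s. r \<le> b \<and> f r = 0"
      using IVT'[of f s 0 b] sb ab continuous_on_subset[OF cont, of "{s..b}"] by auto
    then obtain r where r: "s \<le> r" "r \<le> b" "f r = 0" by blast
    then have "s < r" using \<open>f s < 0\<close> by (cases "s = r") auto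
    then show False using pos[of r] r by simp
  qed
  then show ?thesis using sb pos by blast
qed

text \<open>The left endpoint is a null set; it is also the one point at which
  \<open>last_crossing\<close> gives no strict sign.\<close>

lemma has_integral_le_greaterThanAtMost:
  fixes f g :: "real \<Rightarrow> real"
  assumes f: "(f has_integral i) {a..b}" and g: "(g has_integral j) {a..b}"
    and le: "\<And>r. a < r \<Longrightarrow> r \<le> b \<Longrightarrow> f r \<le> g r"
  shows "i \<le> j"
proof -
  have "((\<lambda>r. if r = a then g r else f r) has_integral i) {a..b}"
    by (rule has_integral_spike_finite[OF _ _ f, of "{a}"]) auto
  then show ?thesis
    by (rule has_integral_le[OF _ g]) (use le in force)
qed

text \<open>The setting covers the law \<mu> and, almost surely, its empirical measures. Full mass
  on the open interval puts the starting price strictly inside \<open>(0,1)\<close>; finitely many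
  atoms leave finitely many exceptional times in the differential equation.\<close>

locale max_price = real_distribution \<nu> for \<nu> :: "real measure" +
  fixes p :: real
  assumes p: "0 < p" "p < 1"
    and carrier: "measure \<nu> {0<..<1} = 1"
    and finite_atoms: "finite {x. measure \<nu> {x} \<noteq> 0}"
begin

abbreviation F :: "real \<Rightarrow> real" where "F \<equiv> cdf \<nu>"
abbreviation Fl :: "real \<Rightarrow> real" where "Fl \<equiv> cdf_left \<nu>"
abbreviation q0 :: real where "q0 \<equiv> quantile \<nu> p"

section \<open>Distribution function and quantile\<close>

lemma cdf_left_eq: "Fl x = measure \<nu> {..<x}"
  unfolding cdf_left_def by (rule tendsto_Lim) (auto simp: cdf_at_left)

lemma cdf_left_mono: "x \<le> y \<Longrightarrow> Fl x \<le> Fl y"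
  unfolding cdf_left_eq by (rule finite_measure_mono) auto

lemma cdf_left_le_cdf: "Fl x \<le> F x"
  unfolding cdf_left_eq cdf_def by (rule finite_measure_mono) auto

lemma cdf_le_cdf_left: "x < y \<Longrightarrow> F x \<le> Fl y"
  unfolding cdf_left_eq cdf_def by (rule finite_measure_mono) auto

lemma cdf_left_nonneg: "0 \<le> Fl x"
  unfolding cdf_left_eq by simp

lemma cdf_left_eq_cdf_iff: "Fl x = F x \<longleftrightarrow> measure \<nu> {x} = 0"
proof -
  have "F x = Fl x + measure \<nu> {x}"
    unfolding cdf_left_eq cdf_def
    by (subst finite_measure_Union[symmetric]) (auto intro!: arg_cong[where f="measure \<nu>"])
  then show ?thesis by simp
qed

lemma AE_carrier: "AE b in \<nu>. 0 < b \<and> b < 1"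
  using prob_eq_1[of "{0<..<1}"] carrier by simp

lemma cdf_eq_0: assumes "x \<le> 0" shows "F x = 0"
proof -
  have "F x = measure \<nu> {}"
    unfolding cdf_def by (rule measure_eq_AE) (use AE_carrier assms in auto)
  then show ?thesis by simp
qed

lemma cdf_left_eq_0: "x \<le> 0 \<Longrightarrow> Fl x = 0"
  using cdf_eq_0[of x] cdf_left_le_cdf[of x] cdf_left_nonneg[of x] by simp

lemma cdf_left_1: "Fl 1 = 1"
proof -
  have "Fl 1 = measure \<nu> {0<..<1}"
    unfolding cdf_left_eq by (rule measure_eq_AE) (use AE_carrier in auto)
  then show ?thesis using carrier by simp
qed

lemma cdf_eq_1: "1 \<le> x \<Longrightarrow> F x = 1"
  using cdf_left_1 cdf_left_le_cdf[of 1] cdf_nondecreasing[of 1 x] cdf_bounded_prob[of x] by simp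

lemma exists_cdf_ge: "\<exists>x. 0 \<le> x \<and> x < 1 \<and> p \<le> F x"
proof -
  have "eventually (\<lambda>x. p < F x) (at_left 1)"
    using cdf_at_left[of 1] cdf_left_1 p unfolding cdf_left_eq by (auto intro: order_tendstoD)
  moreover have "eventually (\<lambda>x::real. 0 < x \<and> x < 1) (at_left 1)"
    by (rule eventually_at_leftI[of 0]) auto
  ultimately have "eventually (\<lambda>x. p < F x \<and> 0 < x \<and> x < 1) (at_left 1)"
    by (rule eventually_conj)
  then obtain x where "p < F x \<and> 0 < x \<and> x < 1"
    using eventually_happens'[OF trivial_limit_at_left_real] by blast
  then show ?thesis by (intro exI[of _ x]) simp
qed

lemma quantile_le: "0 \<le> x \<Longrightarrow> p \<le> F x \<Longrightarrow> q0 \<le> x"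
  unfolding quantile_def by (rule cInf_lower) (auto intro!: bdd_belowI)

lemma cdf_less: "x < q0 \<Longrightarrow> F x < p"
  using quantile_le[of x] cdf_eq_0[of x] p by (cases "0 \<le> x") force+

text \<open>Right continuity of the cdf makes the infimum in \<open>quantile\<close> a
  minimum.\<close>

lemma le_cdf: assumes "q0 \<le> x" shows "p \<le> F x"
proof -
  have *: "p \<le> F y" if "q0 < y" for y
  proof -
    have "{x. 0 \<le> x \<and> p \<le> F x} \<noteq> {}" using exists_cdf_ge by blast
    from cInf_lessD[OF this that[unfolded quantile_def]]
    obtain z where "p \<le> F z" "z < y" by blast
    then show ?thesis using cdf_nondecreasing[of z y] by simp
  qed
  have "p \<le> F q0"
  proof (rule tendsto_lowerbound)
    show "(F \<longlongrightarrow> F q0) (at_right q0)"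
      using cdf_is_right_cont[of q0] by (simp add: continuous_within)
    show "eventually (\<lambda>x. p \<le> F x) (at_right q0)"
      by (rule eventually_at_rightI[of _ "q0 + 1"]) (auto intro: *)
  qed simp
  then show ?thesis using cdf_nondecreasing[OF assms] by simp
qed

lemma quantile_bounds: "0 < q0" "q0 < 1"
proof -
  show "0 < q0" using le_cdf[of q0] cdf_eq_0[of q0] p by (cases "q0 \<le> 0") auto
  show "q0 < 1" using exists_cdf_ge quantile_le by force
qed

lemma cdf_left_le: "x \<le> q0 \<Longrightarrow> Fl x \<le> p"
proof -
  assume "x \<le> q0"
  moreover have "Fl q0 \<le> p"
    unfolding cdf_left_eq
    by (rule tendsto_upperbound[OF cdf_at_left])
       (auto intro!: eventually_at_leftI[of "q0 - 1"] less_imp_le[OF cdf_less])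
  ultimately show ?thesis using cdf_left_mono[of x q0] by simp
qed

lemma le_cdf_left: "q0 < x \<Longrightarrow> p \<le> Fl x"
  using le_cdf[of q0] cdf_le_cdf_left[of q0 x] by simp

section \<open>Bounds and monotonicity of the slope\<close>

lemma slope_above: assumes "q0 < x - t" "0 \<le> t" shows "max_price_slope p \<nu> t x \<le> 1"
proof -
  \<comment> \<open>Here \<open>w <= 0 <= l\<close> and \<open>w + l >= 0\<close>, so the quotient
    is nonpositive, also when \<open>w + l = 0\<close> and division yields 0. Only the default value
    reaches 1.\<close>
  have "p \<le> Fl (x - t)" "p \<le> F (x + t)" "Fl (x - t) \<le> F (x + t)"
    using le_cdf_left le_cdf[of "x + t"] cdf_left_le_cdf[of "x - t"] cdf_nondecreasing[of "x - t" "x + t"] assms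
    by auto
  then show ?thesis
    by (auto simp: max_price_slope_def Let_def divide_simps)
qed

lemma slope_below: assumes "x + t < q0" "0 \<le> t" shows "- 1 \<le> max_price_slope p \<nu> t x"
proof -
  \<comment> \<open>Now \<open>l < 0 < w\<close> and \<open>w + l >= 0\<close>, so the slope is even
    nonnegative.\<close>
  have "F (x + t) < p" "Fl (x - t) \<le> F (x + t)"
    using cdf_less[OF assms(1)] cdf_left_le_cdf[of "x - t"] cdf_nondecreasing[of "x - t" "x + t"] assms
    by auto
  then show ?thesis
    by (auto simp: max_price_slope_def Let_def divide_simps)
qed

lemma slope_cone:
  assumes "\<bar>x - q0\<bar> \<le> t" shows "\<bar>max_price_slope p \<nu> t x\<bar> \<le> 1"
proof -
  have "Fl (x - t) \<le> p" "p \<le> F (x + t)"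
    using assms by (auto intro!: cdf_left_le le_cdf)
  then show ?thesis
    by (auto simp: max_price_slope_def Let_def divide_simps abs_le_iff)
qed

text \<open>As the position grows, \<open>w\<close> falls and \<open>l\<close> rises, both staying
  nonnegative; cross-multiplication leaves \<open>w' * l <= w * l'\<close>. The default value 1 fits
  in: \<open>w' = l' = 0\<close> forces \<open>l = 0\<close>, and then the slope at \<open>x\<close>
  is 1 as well.\<close>

lemma slope_antimono:
  assumes "\<bar>x - q0\<bar> \<le> t" "\<bar>y - q0\<bar> \<le> t" "x \<le> y"
  shows "max_price_slope p \<nu> t y \<le> max_price_slope p \<nu> t x"
proof -
  define w l w' l' where d: "w = p - Fl (x - t)" "l = F (x + t) - p" "w' = p - Fl (y - t)" "l' = F (y + t) - p"
  have "0 \<le> w'" "w' \<le> w" "0 \<le> l" "l \<le> l'"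
    using assms cdf_left_mono[of "x - t" "y - t"] cdf_nondecreasing[of "x + t" "y + t"]
    by (auto simp: d intro!: cdf_left_le le_cdf)
  moreover from this have "w' * l \<le> w * l'" by (intro mult_mono) auto
  ultimately show ?thesis
    unfolding max_price_slope_def d[symmetric] Let_def
    by (auto simp: divide_simps) (auto simp: algebra_simps)
qed

subsection \<open>Uniqueness of solutions\<close>

context
  fixes q assumes q: "solves_max_price_ode p \<nu> q"
begin

lemma solution_0: "q 0 = q0"
  using q by (simp add: solves_max_price_ode_def)

lemma solution_has_integral:
  assumes "0 \<le> s" "s \<le> t"
  shows "((\<lambda>r. max_price_slope p \<nu> r (q r) * indicator {0<..<1} (q r)) has_integral (q t - q s)) {s..t}"
proof -
  let ?v = "\<lambda>r. max_price_slope p \<nu> r (q r) * indicator {0<..<1} (q r)"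
  have i: "(?v has_integral q s - q0) {0..s}" "(?v has_integral q t - q0) {0..t}"
    using q assms by (auto simp: solves_max_price_ode_def)
  have "?v integrable_on {s..t}"
    by (rule integrable_on_subinterval[OF has_integral_integrable[OF i(2)]]) (use assms in simp)
  then obtain j where j: "(?v has_integral j) {s..t}" by blast
  then have "(?v has_integral q s - q0 + j) {0..t}"
    by (intro has_integral_combine[OF assms i(1)])
  then have "q s - q0 + j = q t - q0"
    using i(2) has_integral_unique by blast
  then have "j = q t - q s" by simp
  with j show ?thesis by simp
qed

lemma solution_continuous: "0 \<le> s \<Longrightarrow> continuous_on {s..t} q"
proof -
  let ?v = "\<lambda>r. max_price_slope p \<nu> r (q r) * indicator {0<..<1} (q r)"
  assume s: "0 \<le> s"
  show ?thesis
  proof (cases "s \<le> t")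
    case True
    have "continuous_on {s..t} (\<lambda>r. q s + integral {s..r} ?v)"
      by (intro continuous_intros indefinite_integral_continuous_1)
         (use solution_has_integral[OF s True] in blast)
    moreover have "q s + integral {s..r} ?v = q r" if "r \<in> {s..t}" for r
      using solution_has_integral[OF s, of r] that by (simp add: integral_unique)
    ultimately show ?thesis by (rule continuous_on_eq)
  qed simp
qed

lemma solution_diff_le:
  assumes "0 \<le> s" "s \<le> t"
    and le: "\<And>r. s < r \<Longrightarrow> r \<le> t \<Longrightarrow> max_price_slope p \<nu> r (q r) * indicator {0<..<1} (q r) \<le> c"
  shows "q t - q s \<le> c * (t - s)"
proof -
  have "((\<lambda>_. c) has_integral c * (t - s)) {s..t}"
    using has_integral_const_real[of c s t] assms(2) by (simp add: mult.commute)
  from solution_has_integral[OF assms(1,2)] this show ?thesis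
    by (rule has_integral_le_greaterThanAtMost) (rule le)
qed

lemma solution_diff_ge:
  assumes "0 \<le> s" "s \<le> t"
    and ge: "\<And>r. s < r \<Longrightarrow> r \<le> t \<Longrightarrow> c \<le> max_price_slope p \<nu> r (q r) * indicator {0<..<1} (q r)"
  shows "c * (t - s) \<le> q t - q s"
proof -
  have "((\<lambda>_. c) has_integral c * (t - s)) {s..t}"
    using has_integral_const_real[of c s t] assms(2) by (simp add: mult.commute)
  from this solution_has_integral[OF assms(1,2)] show ?thesis
    by (rule has_integral_le_greaterThanAtMost) (rule ge)
qed

text \<open>To get above the cone the price would have to move faster than 1 after its last contact
  with the upper edge, against \<open>slope_above\<close>. The lower edge is symmetric with
  \<open>slope_below\<close>.\<close>

lemma solution_cone: assumes "0 \<le> t" shows "\<bar>q t - q0\<bar> \<le> t"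
proof -
  have "q t - t \<le> q0"
  proof (rule ccontr)
    assume neg: "\<not> ?thesis"
    have c: "continuous_on {0..t} (\<lambda>r. q r - r - q0)"
      by (intro continuous_on_diff continuous_on_id continuous_on_const solution_continuous order_refl)
    have start: "q 0 - 0 - q0 \<le> 0" by (simp add: solution_0)
    have end_pos: "0 < q t - t - q0" using neg by simp
    obtain s where s: "0 \<le> s" "s < t" "q s - s - q0 = 0" 
      "\<And>r. s < r \<Longrightarrow> r \<le> t \<Longrightarrow> 0 < q r - r - q0"
      using last_crossing[OF c assms start end_pos] by blast
    have "q t - q s \<le> 1 * (t - s)"
    proof (rule solution_diff_le)
      show "max_price_slope p \<nu> r (q r) * indicator {0<..<1} (q r) \<le> 1" if "s < r" "r \<le> t" for r
        using slope_above[of "q r" r] s(4)[OF that] s(1) that by (simp add: indicator_def)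
    qed (use s in simp_all)
    with s neg show False by simp
  qed
  moreover have "q0 \<le> q t + t"
  proof (rule ccontr)
    assume neg: "\<not> ?thesis"
    have c: "continuous_on {0..t} (\<lambda>r. q0 - q r - r)"
      by (intro continuous_on_diff continuous_on_id continuous_on_const solution_continuous order_refl)
    have start: "q0 - q 0 - 0 \<le> 0" by (simp add: solution_0)
    have end_pos: "0 < q0 - q t - t" using neg by simp
    obtain s where s: "0 \<le> s" "s < t" "q0 - q s - s = 0" 
      "\<And>r. s < r \<Longrightarrow> r \<le> t \<Longrightarrow> 0 < q0 - q r - r"
      using last_crossing[OF c assms start end_pos] by blast
    have "(- 1) * (t - s) \<le> q t - q s"
    proof (rule solution_diff_ge)
      show "- 1 \<le> max_price_slope p \<nu> r (q r) * indicator {0<..<1} (q r)" if "s < r" "r \<le> t" for r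
        using slope_below[of "q r" r] s(4)[OF that] s(1) that by (simp add: indicator_def)
    qed (use s in simp_all)
    with s neg show False by simp
  qed
  ultimately show ?thesis by simp
qed

lemma solution_lipschitz: assumes "0 \<le> s" "s \<le> t" shows "\<bar>q t - q s\<bar> \<le> t - s"
proof -
  have "\<bar>max_price_slope p \<nu> r (q r) * indicator {0<..<1} (q r)\<bar> \<le> 1" if "s < r" for r
    using slope_cone[OF solution_cone[of r]] assms that by (auto simp: indicator_def)
  then show ?thesis
    using solution_diff_le[OF assms, of 1] solution_diff_ge[OF assms, of "-1"] by (auto simp: abs_le_iff)
qed

text \<open>Shortly before the hitting time the slope is positive at some \<open>s\<close> with
  \<open>q s + s >= 1\<close>. There \<open>l = 1 - p\<close>, so \<open>w > 1 - p\<close>. Since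
  \<open>q r - r\<close> never increases, \<open>w\<close> never drops, while \<open>l\<close>
  cannot exceed \<open>1 - p\<close>; the slope stays nonnegative and the price cannot fall back.
  Above 1 the indicator stops it.\<close>

lemma solution_absorbed_1:
  assumes T: "0 \<le> T" "q T = 1" "\<And>r. 0 \<le> r \<Longrightarrow> r < T \<Longrightarrow> q r < 1" and t: "T \<le> t"
  shows "q t = 1"
proof -
  have T0: "0 < T" using T(1,2) solution_0 quantile_bounds by (cases "T = 0") auto
  \<comment> \<open>The choice ensures \<open>T < 2 * a\<close>, so for \<open>s\<close> between
    \<open>a\<close> and \<open>T\<close> the Lipschitz bound gives
    \<open>q s + s >= 1 - T + 2 * s > 1\<close>.\<close>
  define a where "a = max (3 * T / 4) (T - 1 / 2)"
  have a: "0 < a" "a < T" "T < 2 * a" "T - a < 1" using T0 by (auto simp: a_def max_def)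
  have "\<exists>s. a < s \<and> s < T \<and> 0 < max_price_slope p \<nu> s (q s)"
  proof (rule ccontr)
    assume "\<not> ?thesis"
    then have neg: "max_price_slope p \<nu> r (q r) \<le> 0" if "a < r" "r < T" for r
      using that by force
    have "q T - q a \<le> 0 * (T - a)"
    proof (rule solution_diff_le)
      show "max_price_slope p \<nu> r (q r) * indicator {0<..<1} (q r) \<le> 0" if "a < r" "r \<le> T" for r
        using neg[of r] that T(2) by (cases "r = T") (simp_all add: indicator_def)
    qed (use a in simp_all)
    then show False using T(2) T(3)[of a] a by simp
  qed
  then obtain s where s: "a < s" "s < T" "0 < max_price_slope p \<nu> s (q s)" by blast
  have "1 \<le> q s + s" using solution_lipschitz[of s T] a s T by simp
  then have l: "F (q s + s) = 1" by (rule cdf_eq_1)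
  have "0 \<le> p - Fl (q s - s)" using solution_cone[of s] a s by (simp add: cdf_left_le)
  then have w: "1 - p < p - Fl (q s - s)"
    using s(3) p l by (auto simp: max_price_slope_def Let_def zero_less_divide_iff split: if_splits)
  have later: "0 \<le> max_price_slope p \<nu> r (q r)" if "s \<le> r" for r
  proof -
    have "1 - p < p - Fl (q r - r)" 
      using w cdf_left_mono[of "q r - r" "q s - s"] solution_lipschitz[of s r] s a that by (auto simp: abs_le_iff)
    moreover have "F (q r + r) \<le> 1" by (rule cdf_bounded_prob)
    moreover have "p \<le> F (q r + r)" using solution_cone[of r] s a that by (intro le_cdf) auto
    ultimately show ?thesis by (auto simp: max_price_slope_def Let_def divide_simps)
  qed
  show ?thesis
  proof (rule ccontr)
    assume "q t \<noteq> 1"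
    then consider "1 < q t" | "q t < 1" by linarith
    then show False
    proof cases
      case 1
      have c: "continuous_on {T..t} (\<lambda>r. q r - 1)"
        by (intro continuous_on_diff continuous_on_id continuous_on_const solution_continuous T(1))
      have start: "q T - 1 \<le> 0" by (simp add: T)
      have end_pos: "0 < q t - 1" using 1 by simp
      obtain u where u: "T \<le> u" "u < t" "q u - 1 = 0" "\<And>r. u < r \<Longrightarrow> r \<le> t \<Longrightarrow> 0 < q r - 1"
        using last_crossing[OF c t start end_pos] by blast
      have "q t - q u \<le> 0 * (t - u)"
      proof (rule solution_diff_le)
        show "max_price_slope p \<nu> r (q r) * indicator {0<..<1} (q r) \<le> 0" if "u < r" "r \<le> t" for r
          using u(4)[OF that] by (simp add: indicator_def)
      qed (use u T in simp_all)
      with u 1 show False by simp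
    next
      case 2
      have c: "continuous_on {T..t} (\<lambda>r. 1 - q r)"
        by (intro continuous_on_diff continuous_on_id continuous_on_const solution_continuous T(1))
      have start: "1 - q T \<le> 0" by (simp add: T)
      have end_pos: "0 < 1 - q t" using 2 by simp
      obtain u where u: "T \<le> u" "u < t" "1 - q u = 0" "\<And>r. u < r \<Longrightarrow> r \<le> t \<Longrightarrow> 0 < 1 - q r"
        using last_crossing[OF c t start end_pos] by blast
      have "0 * (t - u) \<le> q t - q u"
      proof (rule solution_diff_ge)
        show "0 \<le> max_price_slope p \<nu> r (q r) * indicator {0<..<1} (q r)" if "u < r" "r \<le> t" for r
          using later[of r] u that s by (simp add: indicator_def)
      qed (use u T in simp_all)
      with u 2 show False by simp
    qed
  qed
qed

text \<open>Mirror image of \<open>solution_absorbed_1\<close>: before the hitting time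
  \<open>q s - s <= 0\<close>, so \<open>w = p\<close>; a negative slope gives \<open>l > p\<close>,
  and \<open>l\<close> never drops because \<open>q r + r\<close> never decreases.\<close>

lemma solution_absorbed_0:
  assumes T: "0 \<le> T" "q T = 0" "\<And>r. 0 \<le> r \<Longrightarrow> r < T \<Longrightarrow> 0 < q r" and t: "T \<le> t"
  shows "q t = 0"
proof -
  have T0: "0 < T" using T(1,2) solution_0 quantile_bounds by (cases "T = 0") auto
  define a where "a = max (3 * T / 4) (T - 1 / 2)"
  have a: "0 < a" "a < T" "T < 2 * a" "T - a < 1" using T0 by (auto simp: a_def max_def)
  have "\<exists>s. a < s \<and> s < T \<and> max_price_slope p \<nu> s (q s) < 0"
  proof (rule ccontr)
    assume "\<not> ?thesis"
    then have pos: "0 \<le> max_price_slope p \<nu> r (q r)" if "a < r" "r < T" for r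
      using that by force
    have "0 * (T - a) \<le> q T - q a"
    proof (rule solution_diff_ge)
      show "0 \<le> max_price_slope p \<nu> r (q r) * indicator {0<..<1} (q r)" if "a < r" "r \<le> T" for r
        using pos[of r] that T(2) by (cases "r = T") (simp_all add: indicator_def)
    qed (use a in simp_all)
    then show False using T(2) T(3)[of a] a by simp
  qed
  then obtain s where s: "a < s" "s < T" "max_price_slope p \<nu> s (q s) < 0" by blast
  have "q s - s \<le> 0" using solution_lipschitz[of s T] a s T by simp
  then have w: "Fl (q s - s) = 0" by (rule cdf_left_eq_0)
  have "0 \<le> F (q s + s) - p" using solution_cone[of s] a s by (simp add: le_cdf)
  then have l: "p < F (q s + s) - p"
    using s(3) p w by (auto simp: max_price_slope_def Let_def divide_less_0_iff split: if_splits)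
  have later: "max_price_slope p \<nu> r (q r) \<le> 0" if "s \<le> r" for r
  proof -
    have "p < F (q r + r) - p"
      using l cdf_nondecreasing[of "q s + s" "q r + r"] solution_lipschitz[of s r] s a that
      by (auto simp: abs_le_iff)
    moreover have "0 \<le> Fl (q r - r)" by (rule cdf_left_nonneg)
    moreover have "Fl (q r - r) \<le> p" using solution_cone[of r] s a that by (intro cdf_left_le) auto
    ultimately show ?thesis by (auto simp: max_price_slope_def Let_def divide_simps)
  qed
  show ?thesis
  proof (rule ccontr)
    assume "q t \<noteq> 0"
    then consider "q t < 0" | "0 < q t" by linarith
    then show False
    proof cases
      case 1
      have c: "continuous_on {T..t} (\<lambda>r. 0 - q r)"
        by (intro continuous_on_diff continuous_on_id continuous_on_const solution_continuous T(1))
      have start: "0 - q T \<le> 0" by (simp add: T)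
      have end_pos: "0 < 0 - q t" using 1 by simp
      obtain u where u: "T \<le> u" "u < t" "0 - q u = 0" "\<And>r. u < r \<Longrightarrow> r \<le> t \<Longrightarrow> 0 < 0 - q r"
        using last_crossing[OF c t start end_pos] by blast
      have "0 * (t - u) \<le> q t - q u"
      proof (rule solution_diff_ge)
        show "0 \<le> max_price_slope p \<nu> r (q r) * indicator {0<..<1} (q r)" if "u < r" "r \<le> t" for r
          using u(4)[OF that] by (simp add: indicator_def)
      qed (use u T in simp_all)
      with u 1 show False by simp
    next
      case 2
      have c: "continuous_on {T..t} q"
        by (intro continuous_on_diff continuous_on_id continuous_on_const solution_continuous T(1))
      have start: "q T \<le> 0" by (simp add: T)
      have end_pos: "0 < q t" using 2 by simp
      obtain u where u: "T \<le> u" "u < t" "q u = 0" "\<And>r. u < r \<Longrightarrow> r \<le> t \<Longrightarrow> 0 < q r"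
        using last_crossing[OF c t start end_pos] by blast
      have "q t - q u \<le> 0 * (t - u)"
      proof (rule solution_diff_le)
        show "max_price_slope p \<nu> r (q r) * indicator {0<..<1} (q r) \<le> 0" if "u < r" "r \<le> t" for r
          using later[of r] u that s by (simp add: indicator_def)
      qed (use u T in simp_all)
      with u 2 show False by simp
    qed
  qed
qed

text \<open>By continuity the price at its first time outside \<open>(0,1)\<close> is exactly 0 or
  1, and from then on one of the two preceding lemmas fixes it.\<close>

lemma solution_absorbed:
  assumes T: "0 \<le> T" "q T \<notin> {0<..<1}" and t: "T \<le> t"
  shows "q t = q T"
proof -
  define S where "S = {0..T} \<inter> q -` ({..0} \<union> {1..})"
  have "closed S"
    unfolding S_def
    by (intro continuous_closed_preimage solution_continuous closed_Un closed_atMost closed_atLeast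
        closed_atLeastAtMost order_refl)
  moreover have "S \<subseteq> {0..T}" by (simp add: S_def)
  ultimately have "compact S"
    using bounded_subset[OF bounded_closed_interval] compact_eq_bounded_closed by metis
  moreover have "T \<in> S" using T by (auto simp: S_def)
  ultimately obtain u where u: "u \<in> S" "\<And>r. r \<in> S \<Longrightarrow> u \<le> r"
    using compact_attains_inf[of S] by auto
  have uT: "0 \<le> u" "u \<le> T" using u by (auto simp: S_def)
  have before: "0 < q r \<and> q r < 1" if "0 \<le> r" "r < u" for r
    using u(2)[of r] that uT by (force simp: S_def)
  have cont: "continuous_on {0..u} q" by (rule solution_continuous) simp
  consider "q u \<le> 0" | "1 \<le> q u" using u by (auto simp: S_def)
  then show ?thesis
  proof cases
    case 1
    obtain r where "0 \<le> r" "r \<le> u" "q r = 0"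
      using IVT2'[of q u 0 0] 1 uT cont quantile_bounds by (auto simp: solution_0)
    then have "q u = 0" using before[of r] by (cases "r = u") auto
    then show ?thesis
      using solution_absorbed_0[of u] before uT t by auto
  next
    case 2
    obtain r where "0 \<le> r" "r \<le> u" "q r = 1"
      using IVT'[of q 0 1 u] 2 uT cont quantile_bounds by (auto simp: solution_0)
    then have "q u = 1" using before[of r] by (cases "r = u") auto
    then show ?thesis
      using solution_absorbed_1[of u] before uT t by auto
  qed
qed

end

text \<open>After the last time \<open>s\<close> of equality \<open>q\<close> lies above
  \<open>r\<close>, so inside \<open>(0,1)\<close> its slope is at most that of \<open>r\<close> by
  \<open>slope_antimono\<close>, and the gap cannot open. If the common value is outside
  \<open>(0,1)\<close>, both solutions are frozen.\<close>

lemma solution_le: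
  assumes q: "solves_max_price_ode p \<nu> q" and r: "solves_max_price_ode p \<nu> r" and t: "0 \<le> t"
  shows "q t \<le> r t"
proof (rule ccontr)
  assume neg: "\<not> ?thesis"
  have c: "continuous_on {0..t} (\<lambda>u. q u - r u)"
    by (intro continuous_on_diff continuous_on_id continuous_on_const solution_continuous q r order_refl)
  have start: "q 0 - r 0 \<le> 0" using solution_0[OF q] solution_0[OF r] by simp
  have end_pos: "0 < q t - r t" using neg by simp
  obtain s where s: "0 \<le> s" "s < t" "q s - r s = 0" "\<And>u. s < u \<Longrightarrow> u \<le> t \<Longrightarrow> 0 < q u - r u"
    using last_crossing[OF c t start end_pos] by blast
  have inside: "q s \<in> {0<..<1}"
  proof (rule ccontr)
    assume "q s \<notin> {0<..<1}"
    moreover from this have "r s \<notin> {0<..<1}" using s(3) by simp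
    ultimately have "q t = q s" "r t = r s"
      using solution_absorbed[OF q s(1) _ less_imp_le[OF s(2)]]
        solution_absorbed[OF r s(1) _ less_imp_le[OF s(2)]] by blast+
    then show False using s(3) s(4)[of t] s(2) by simp
  qed
  \<comment> \<open>For a time of half the distance to the boundary, the Lipschitz bound keeps both
    solutions inside \<open>(0,1)\<close>.\<close>
  define d where "d = min (t - s) (min (q s) (1 - q s) / 2)"
  have d: "0 < d" "s + d \<le> t" "d < q s" "d < 1 - q s" using s(1-3) inside by (auto simp: d_def min_def)
  have "q (s + d) - q s \<le> r (s + d) - r s"
  proof (rule has_integral_le_greaterThanAtMost[OF solution_has_integral[OF q] solution_has_integral[OF r]])
    fix u assume u: "s < u" "u \<le> s + d"
    have "\<bar>q u - q s\<bar> \<le> d" "\<bar>r u - r s\<bar> \<le> d"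
      using solution_lipschitz[OF q, of s u] solution_lipschitz[OF r, of s u] u s by auto
    then have "q u \<in> {0<..<1}" "r u \<in> {0<..<1}" using d s by auto
    moreover have "max_price_slope p \<nu> u (q u) \<le> max_price_slope p \<nu> u (r u)"
      using u s(1,4) d(2) by (intro slope_antimono solution_cone q r less_imp_le[of "r u" "q u"]) auto
    ultimately show "max_price_slope p \<nu> u (q u) * indicator {0<..<1} (q u)
        \<le> max_price_slope p \<nu> u (r u) * indicator {0<..<1} (r u)" by simp
  qed (use s d in auto)
  with s(4)[of "s + d"] s(3) d show False by simp
qed

subsection \<open>The free price\<close>

text \<open>Up to a constant, the excess is the primitive of \<open>F - p\<close>; as an expectation it needs no Fubini argument.\<close>

definition excess :: "real \<Rightarrow> real" where
  "excess x = (\<integral>b. max 0 (x - b) \<partial>\<nu>) - p * x"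

lemma integrable_call: "integrable \<nu> (\<lambda>b. max 0 (x - b))"
  by (rule integrable_const_bound[where B="\<bar>x\<bar>"]) (use AE_carrier in auto)

lemma excess_diff: 
  "excess y - excess x = (\<integral>b. max 0 (y - b) - max 0 (x - b) \<partial>\<nu>) - p * (y - x)"
  unfolding excess_def by (simp add: Bochner_Integration.integral_diff integrable_call algebra_simps)

lemma integrable_scaled_indicator: "A \<in> sets borel \<Longrightarrow> integrable \<nu> (\<lambda>b. c * indicator A b :: real)"
  by (intro integrable_mult_right integrable_real_indicator) (auto simp: emeasure_eq_measure)

lemma integrable_call_spread: "integrable \<nu> (\<lambda>b. max 0 (y - b) - max 0 (x - b))"
  by (intro Bochner_Integration.integrable_diff integrable_call)

text \<open>The spread \<open>max 0 (y - b) - max 0 (x - b)\<close> is \<open>y - x\<close> for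
  \<open>b <= x\<close>, 0 for \<open>b >= y\<close>, and in between otherwise. Together with
  \<open>excess_diff_le\<close> this is the form in which convexity is used.\<close>

lemma excess_diff_ge: assumes "x \<le> y" shows "(y - x) * (F x - p) \<le> excess y - excess x"
proof -
  have "(y - x) * F x = (\<integral>b. (y - x) * indicator {..x} b \<partial>\<nu>)"
    by (simp add: cdf_def)
  also have "\<dots> \<le> (\<integral>b. max 0 (y - b) - max 0 (x - b) \<partial>\<nu>)"
    by (intro integral_mono integrable_scaled_indicator integrable_call_spread)
       (use assms in \<open>auto simp: indicator_def\<close>)
  finally show ?thesis by (simp add: excess_diff algebra_simps)
qed

lemma excess_diff_le: assumes "x \<le> y" shows "excess y - excess x \<le> (y - x) * (Fl y - p)"
proof -
  have "(\<integral>b. max 0 (y - b) - max 0 (x - b) \<partial>\<nu>) \<le> (\<integral>b. (y - x) * indicator {..<y} b \<partial>\<nu>)"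
    by (intro integral_mono integrable_scaled_indicator integrable_call_spread)
       (use assms in \<open>auto simp: indicator_def\<close>)
  also have "\<dots> = (y - x) * Fl y"
    by (simp add: cdf_left_eq)
  finally show ?thesis by (simp add: excess_diff algebra_simps)
qed

lemma excess_diff_le_cdf: "x \<le> y \<Longrightarrow> excess y - excess x \<le> (y - x) * (F y - p)"
  using excess_diff_le[of x y] mult_left_mono[of "Fl y - p" "F y - p" "y - x"] cdf_left_le_cdf[of y]
  by simp

lemma excess_strict_antimono: assumes "x < y" "y \<le> q0" shows "excess y < excess x"
proof -
  \<comment> \<open>At \<open>y = q0\<close> the left limit of the cdf may equal \<open>p\<close>,
    so the strict decrease comes from the half left of \<open>m\<close>.\<close>
  define m where "m = (x + y) / 2"
  have m: "x < m" "m < y" "m < q0" using assms by (auto simp: m_def)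
  have "excess m - excess x \<le> (m - x) * (Fl m - p)" using m by (intro excess_diff_le) simp
  also have "\<dots> < 0"
    using m cdf_less[of m] cdf_left_le_cdf[of m] by (simp add: mult_pos_neg)
  finally have "excess m < excess x" by simp
  moreover have "excess y - excess m \<le> (y - m) * (Fl y - p)" using m by (intro excess_diff_le) simp
  moreover have "(y - m) * (Fl y - p) \<le> 0"
    using m assms cdf_left_le[of y] by (simp add: mult_nonneg_nonpos)
  ultimately show ?thesis by simp
qed

lemma excess_antimono: "x \<le> y \<Longrightarrow> y \<le> q0 \<Longrightarrow> excess y \<le> excess x"
  using excess_strict_antimono[of x y] by (cases "x = y") auto

lemma excess_mono: assumes "q0 \<le> x" "x \<le> y" shows "excess x \<le> excess y"
proof -
  have "0 \<le> (y - x) * (F x - p)" using assms le_cdf[of x] by simp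
  then show ?thesis using excess_diff_ge[of x y] assms by simp
qed

lemma excess_strict_mono:
  assumes "q0 \<le> x" "x < y" "p < F x" shows "excess x < excess y"
proof -
  have "0 < (y - x) * (F x - p)" using assms by simp
  then show ?thesis using excess_diff_ge[OF less_imp_le[OF assms(2)]] by linarith
qed

text \<open>Were \<open>F x <= p\<close>, the slope of \<open>excess\<close> would be nonpositive up
  to \<open>x\<close>, leaving no room for a rise.\<close>

lemma less_cdf: assumes "q0 \<le> x" "excess q0 < excess x" shows "p < F x"
proof (rule ccontr)
  assume "\<not> p < F x"
  then have "Fl x - p \<le> 0" using cdf_left_le_cdf[of x] by simp
  then have "(x - q0) * (Fl x - p) \<le> 0" using assms by (simp add: mult_nonneg_nonpos)
  then show False using excess_diff_le[of q0 x] assms by simp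
qed

lemma excess_lipschitz: "\<bar>excess y - excess x\<bar> \<le> \<bar>y - x\<bar>"
proof -
  have *: "\<bar>excess y - excess x\<bar> \<le> y - x" if "x \<le> y" for x y
  proof -
    have "- 1 \<le> F x - p" "Fl y - p \<le> 1"
      using p cdf_nonneg[of x] cdf_left_le_cdf[of y] cdf_bounded_prob[of y] by linarith+
    then have "(y - x) * (- 1) \<le> (y - x) * (F x - p)" "(y - x) * (Fl y - p) \<le> (y - x) * 1"
      using that by (intro mult_left_mono; simp)+
    then show ?thesis using excess_diff_ge[OF that] excess_diff_le[OF that] by simp
  qed
  show ?thesis using *[of x y] *[of y x] by (cases "x \<le> y") auto
qed

lemma isCont_excess: "isCont excess x"
  unfolding isCont_def
  by (rule LIM_zero_cancel, rule Lim_null_comparison[where g="\<lambda>y. \<bar>y - x\<bar>"])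
     (auto simp: excess_lipschitz intro!: always_eventually tendsto_eq_intros)

text \<open>The convexity bounds squeeze the difference quotient between \<open>F x - p\<close> and
  \<open>F (x + h) - p\<close>, and the cdf is continuous off atoms.\<close>

lemma excess_deriv: assumes "measure \<nu> {x} = 0" shows "(excess has_real_derivative F x - p) (at x)"
  unfolding DERIV_def
proof (rule LIM_zero_cancel, rule Lim_null_comparison[where g="\<lambda>h. \<bar>F (x + h) - F x\<bar>"])
  have "isCont F x" using assms isCont_cdf by simp
  then show "((\<lambda>h. \<bar>F (x + h) - F x\<bar>) \<longlongrightarrow> 0) (at 0)"
    by (intro tendsto_rabs_zero LIM_zero) (simp add: isCont_iff)
  have "norm ((excess (x + h) - excess x) / h - (F x - p)) \<le> \<bar>F (x + h) - F x\<bar>" if "h \<noteq> 0" for h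
  proof (cases "0 < h")
    case True
    have "h * (F x - p) \<le> excess (x + h) - excess x" 
      "excess (x + h) - excess x \<le> h * (F (x + h) - p)"
      using excess_diff_ge[of x "x + h"] excess_diff_le[of x "x + h"] True cdf_left_le_cdf[of "x + h"]
      by (auto intro: order_trans[OF _ mult_left_mono])
    then have "F x - p \<le> (excess (x + h) - excess x) / h" "(excess (x + h) - excess x) / h \<le> F (x + h) - p"
      using True by (simp_all add: field_simps)
    then show ?thesis by (simp add: abs_le_iff)
  next
    case False
    then have h: "h < 0" using that by simp
    have "Fl x = F x" using assms cdf_left_eq_cdf_iff by simp
    then have "(- h) * (F (x + h) - p) \<le> excess x - excess (x + h)"
      "excess x - excess (x + h) \<le> (- h) * (F x - p)"
      using excess_diff_ge[of "x + h" x] excess_diff_le[of "x + h" x] h by auto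
    then have "F (x + h) - p \<le> (excess (x + h) - excess x) / h" "(excess (x + h) - excess x) / h \<le> F x - p"
      using h by (simp_all add: field_simps)
    then show ?thesis by (simp add: abs_le_iff)
  qed
  then show "\<forall>\<^sub>F h in at 0. norm ((excess (x + h) - excess x) / h - (F x - p)) \<le> \<bar>F (x + h) - F x\<bar>"
    by (auto simp: eventually_at intro!: exI[of _ 1])
qed

text \<open>This is the point x_t of the explicit solution before truncation: the difference of the
  two excesses is the integral of \<open>F\<close> over \<open>[x - t, x + t]\<close> minus
  \<open>2 * p * t\<close>. With \<open>SOME\<close>, existence alone yields the defining
  properties.\<close>

definition free_price :: "real \<Rightarrow> real" where
  "free_price t = (SOME x. \<bar>x - q0\<bar> \<le> t \<and> excess (x + t) = excess (x - t))"

text \<open>Existence is by the intermediate value theorem: centred at \<open>q0 - t\<close> the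
  window lies where \<open>excess\<close> falls, centred at \<open>q0 + t\<close> where it does not
  fall.\<close>

lemma free_price:
  assumes "0 \<le> t"
  shows "free_price t - t \<le> q0" "q0 \<le> free_price t + t"
    "excess (free_price t + t) = excess (free_price t - t)"
    "\<bar>free_price t - q0\<bar> \<le> t"
proof -
  have "continuous_on {q0 - t..q0 + t} (\<lambda>x. excess (x + t) - excess (x - t))"
    by (intro continuous_at_imp_continuous_on ballI continuous_intros isCont_o2[OF _ isCont_excess])
  then have "\<exists>x\<ge>q0 - t. x \<le> q0 + t \<and> excess (x + t) - excess (x - t) = 0"
    using assms excess_antimono[of "q0 - 2 * t" q0] excess_mono[of q0 "q0 + 2 * t"]
    by (intro IVT') (auto simp: algebra_simps)
  then obtain x where "x \<ge> q0 - t" "x \<le> q0 + t" "excess (x + t) - excess (x - t) = 0" by blast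
  then have "\<bar>x - q0\<bar> \<le> t \<and> excess (x + t) = excess (x - t)" by auto
  then have "\<bar>free_price t - q0\<bar> \<le> t \<and> excess (free_price t + t) = excess (free_price t - t)"
    unfolding free_price_def by (rule someI)
  then show "free_price t - t \<le> q0" "q0 \<le> free_price t + t"
    "excess (free_price t + t) = excess (free_price t - t)" "\<bar>free_price t - q0\<bar> \<le> t"
    by auto
qed

lemma free_price_0: "free_price 0 = q0"
  using free_price(4)[of 0] by simp

text \<open>The window around the free price has its two ends at equal height on the two sides of a
  valley with bottom \<open>q0\<close>. If one end moved inwards as \<open>t\<close> grows, so would
  the other, yet the width \<open>2 * t\<close> increases. So both ends move outwards.\<close>

lemma free_price_lipschitz:
  assumes "0 \<le> s" "s \<le> t" shows "\<bar>free_price t - free_price s\<bar> \<le> t - s"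
proof -
  note fp = free_price[OF assms(1)] free_price[OF order_trans[OF assms]]
  have "free_price t - t \<le> free_price s - s"
  proof (rule ccontr)
    assume "\<not> ?thesis"
    then have "excess (free_price t - t) < excess (free_price s - s)"
      using fp by (intro excess_strict_antimono) auto
    then have "free_price t + t < free_price s + s"
      using fp excess_mono[of "free_price s + s" "free_price t + t"] by fastforce
    with \<open>\<not> ?thesis\<close> assms show False by simp
  qed
  moreover have "free_price s + s \<le> free_price t + t"
  proof (rule ccontr)
    assume "\<not> ?thesis"
    then have "excess (free_price t + t) \<le> excess (free_price s + s)"
      using fp by (intro excess_mono) auto
    then have "free_price s - s \<le> free_price t - t"
      using fp excess_strict_antimono[of "free_price t - t" "free_price s - s"] by fastforce
    with \<open>\<not> ?thesis\<close> assms show False by simp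
  qed
  ultimately show ?thesis by (auto simp: abs_le_iff)
qed

lemma free_price_lipschitz': "0 \<le> s \<Longrightarrow> 0 \<le> t \<Longrightarrow> \<bar>free_price t - free_price s\<bar> \<le> \<bar>t - s\<bar>"
  using free_price_lipschitz[of s t] free_price_lipschitz[of t s] by (cases "s \<le> t") auto

section \<open>Differentiability of the free price\<close>

lemma isCont_free_price: assumes "0 < t" shows "isCont free_price t"
  unfolding isCont_def
proof (rule LIM_zero_cancel, rule Lim_null_comparison[where g="\<lambda>s. \<bar>s - t\<bar>"])
  have "\<forall>\<^sub>F s in at t. 0 < s" 
    using order_tendstoD(1)[OF tendsto_ident_at assms] .
  then show "\<forall>\<^sub>F s in at t. norm (free_price s - free_price t) \<le> \<bar>s - t\<bar>"
    by eventually_elim (use assms free_price_lipschitz' in auto)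
qed (auto intro!: tendsto_eq_intros)

text \<open>Once the left end is below \<open>q0\<close>, the height exceeds the bottom, so
  \<open>less_cdf\<close> makes the right branch strictly increasing too. Then neither end can rest
  while the window widens.\<close>

lemma free_price_strict:
  assumes "0 \<le> s" "s < t" "free_price s - s < q0"
  shows "free_price t - t < free_price s - s" "free_price s + s < free_price t + t"
proof -
  note fs = free_price[OF assms(1)] and ft = free_price[of t]
  have lip: "free_price t - t \<le> free_price s - s" "free_price s + s \<le> free_price t + t"
    using free_price_lipschitz[of s t] assms by (auto simp: abs_le_iff)
  have "excess q0 < excess (free_price s + s)"
    using excess_strict_antimono[OF assms(3)] fs(3) by simp
  then have above: "p < F (free_price s + s)" using less_cdf fs(2) by simp
  show less: "free_price s + s < free_price t + t"
  proof (rule ccontr)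
    assume "\<not> ?thesis"
    with lip have eq: "free_price s + s = free_price t + t" by simp
    then have "excess (free_price t - t) = excess (free_price s - s)"
      using fs(3) ft(3) assms by simp
    then have "free_price t - t = free_price s - s"
      using excess_strict_antimono[of "free_price t - t" "free_price s - s"] lip(1) fs(1) by fastforce
    with eq assms show False by simp
  qed
  have "excess (free_price s + s) < excess (free_price t + t)"
    using less above fs(2) by (intro excess_strict_mono)
  then have "free_price t - t \<noteq> free_price s - s"
    using fs(3) ft(3) assms by auto
  with lip show "free_price t - t < free_price s - s" by simp
qed

text \<open>The exceptional times are the last time at which the left end rests at
  \<open>q0\<close>, and the times at which an end meets an atom. By strict motion each end meets
  each atom at most once after leaving \<open>q0\<close>.\<close>

lemma finite_free_price_exceptional:
  "finite {t. 0 \<le> t \<and> free_price t - t = q0 \<and> (\<forall>s>t. free_price s - s \<noteq> q0)}" (is "finite ?A")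
  "finite {t. 0 \<le> t \<and> free_price t - t < q0 \<and> measure \<nu> {free_price t - t} \<noteq> 0}" (is "finite ?B")
  "finite {t. 0 \<le> t \<and> free_price t - t < q0 \<and> measure \<nu> {free_price t + t} \<noteq> 0}" (is "finite ?C")
proof -
  have "s = t" if "s \<in> ?A" "t \<in> ?A" for s t
    using that by (cases s t rule: linorder_cases) auto
  then have "?A = {} \<or> (\<exists>t. ?A \<subseteq> {t})" by blast
  then show "finite ?A"
  proof (elim disjE exE)
    show "finite ?A" if "?A = {}" unfolding that by (rule finite.emptyI)
    show "finite ?A" if "?A \<subseteq> {t}" for t using that by (rule finite_subset) simp
  qed
  have "free_price s - s \<noteq> free_price t - t \<and> free_price s + s \<noteq> free_price t + t"
    if "s \<noteq> t" "0 \<le> s" "0 \<le> t" "free_price s - s < q0" "free_price t - t < q0" for s t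
    using that free_price_strict[of s t] free_price_strict[of t s]
    by (cases s t rule: linorder_cases) simp_all
  then have "inj_on (\<lambda>t. free_price t - t) ?B" "inj_on (\<lambda>t. free_price t + t) ?C"
    unfolding inj_on_def by blast+
  moreover have "finite ((\<lambda>t. free_price t - t) ` ?B)" "finite ((\<lambda>t. free_price t + t) ` ?C)"
    by (rule finite_subset[OF _ finite_atoms]; auto)+
  ultimately show "finite ?B" "finite ?C" using finite_imageD by blast+
qed

lemma free_price_deriv_flat:
  assumes t: "0 < t" "t < s" "free_price s - s = q0"
  shows "(free_price has_real_derivative max_price_slope p \<nu> t (free_price t)) (at t)"
proof -
  \<comment> \<open>The left end never moves right and starts at \<open>q0\<close>; being there at
    \<open>s\<close>, it has rested there throughout.\<close>
  have eq: "free_price r = q0 + r" if "0 \<le> r" "r \<le> s" for r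
    using free_price_lipschitz[of r s] free_price(1)[of r] that t by (auto simp: abs_le_iff)
  have "F (q0 + 2 * t) = p"
  proof (rule antisym)
    show "p \<le> F (q0 + 2 * t)" using t by (intro le_cdf) simp
    show "F (q0 + 2 * t) \<le> p"
    proof (rule ccontr)
      assume "\<not> ?thesis"
      then have "excess (q0 + 2 * t) < excess (q0 + 2 * s)"
        using t by (intro excess_strict_mono) auto
      moreover have "excess q0 \<le> excess (q0 + 2 * t)" using t by (intro excess_mono) auto
      moreover have "q0 + 2 * s = free_price s + s" using t by simp
      then have "excess (q0 + 2 * s) = excess q0" using free_price(3)[of s] t by (simp only:)
      ultimately show False by simp
    qed
  qed
  moreover have "Fl q0 \<le> p" by (rule cdf_left_le) simp
  \<comment> \<open>With \<open>l = 0\<close> the slope is \<open>w / w = 1\<close> if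
    \<open>w > 0\<close>, and the default 1 if the cdf has no jump at \<open>q0\<close>.\<close>
  ultimately have slope: "max_price_slope p \<nu> t (free_price t) = 1"
    using eq[of t] t by (auto simp: max_price_slope_def Let_def ac_simps)
  have "((\<lambda>r. q0 + r) has_real_derivative 1) (at t)" by (auto intro!: derivative_eq_intros)
  then have "(free_price has_real_derivative 1) (at t)"
    by (rule has_field_derivative_transform_within_open[where S="{0<..<s}"]) (use t eq in auto)
  with slope show ?thesis by simp
qed

text \<open>Implicit differentiation of \<open>excess (b r) = excess (a r)\<close>, with
  Caratheodory's difference quotients \<open>g\<close> and \<open>h\<close> at the two ends. The
  denominator \<open>h - g\<close> tends to \<open>w + l\<close>, which is positive because the left
  end is below \<open>q0\<close>.\<close>

lemma free_price_deriv_regular: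
  assumes t: "0 < t" "free_price t - t < q0"
    and no_atom: "measure \<nu> {free_price t - t} = 0" "measure \<nu> {free_price t + t} = 0"
  shows "(free_price has_real_derivative max_price_slope p \<nu> t (free_price t)) (at t)"
proof -
  define a b where "a r = free_price r - r" and "b r = free_price r + r" for r
  have Fa: "Fl (a t) = F (a t)" using no_atom cdf_left_eq_cdf_iff a_def by simp
  have w: "0 < p - F (a t)" using cdf_less t a_def by simp
  have l: "0 \<le> F (b t) - p" using le_cdf free_price(2)[of t] t b_def by simp
  obtain g where g: "\<And>z. excess z - excess (a t) = g z * (z - a t)" "isCont g (a t)" "g (a t) = F (a t) - p"
    using excess_deriv[of "a t"] no_atom unfolding CARAT_DERIV a_def by blast
  obtain h where h: "\<And>z. excess z - excess (b t) = h z * (z - b t)" "isCont h (b t)" "h (b t) = F (b t) - p"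
    using excess_deriv[of "b t"] no_atom unfolding CARAT_DERIV b_def by blast
  have cont: "isCont a t" "isCont b t"
    unfolding a_def b_def by (intro continuous_intros isCont_free_price t)+
  have lim: "((\<lambda>r. g (a r)) \<longlongrightarrow> F (a t) - p) (at t)" "((\<lambda>r. h (b r)) \<longlongrightarrow> F (b t) - p) (at t)"
    using isCont_o2[OF cont(1) g(2)] isCont_o2[OF cont(2) h(2)] g(3) h(3) by (simp_all add: isCont_def)
  have "((\<lambda>r. h (b r) - g (a r)) \<longlongrightarrow> (F (b t) - p) - (F (a t) - p)) (at t)"
    by (intro tendsto_diff lim)
  then have "\<forall>\<^sub>F r in at t. 0 < h (b r) - g (a r)"
    by (rule order_tendstoD) (use w l in simp)
  moreover have "\<forall>\<^sub>F r in at t. 0 < r"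
    using order_tendstoD(1)[OF tendsto_ident_at t(1)] .
  moreover have "\<forall>\<^sub>F r in at t. r \<noteq> t" by (simp add: eventually_at_filter)
  \<comment> \<open>The ends change by the price change plus or minus \<open>r - t\<close>, so
    equality of the two changes of \<open>excess\<close> is a linear equation for the price
    change.\<close>
  ultimately have ev: "\<forall>\<^sub>F r in at t. - (h (b r) + g (a r)) / (h (b r) - g (a r)) = (free_price r - free_price t) / (r - t)"
  proof eventually_elim
    case (elim r)
    have "excess (b r) - excess (b t) = excess (a r) - excess (a t)"
      using free_price(3)[of r] free_price(3)[of t] elim t by (simp add: a_def b_def)
    then have "h (b r) * (b r - b t) = g (a r) * (a r - a t)" using g(1) h(1) by simp
    then show ?case
      using elim by (simp add: a_def b_def field_simps)
  qed
  have "((\<lambda>r. - (h (b r) + g (a r)) / (h (b r) - g (a r))) \<longlongrightarrow>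
      - ((F (b t) - p) + (F (a t) - p)) / ((F (b t) - p) - (F (a t) - p))) (at t)"
    by (intro tendsto_intros lim) (use w l in simp)
  then have "((\<lambda>r. (free_price r - free_price t) / (r - t)) \<longlongrightarrow>
      - ((F (b t) - p) + (F (a t) - p)) / ((F (b t) - p) - (F (a t) - p))) (at t)"
    by (rule Lim_transform_eventually) (rule ev)
  moreover have "max_price_slope p \<nu> t (free_price t) =
      - ((F (b t) - p) + (F (a t) - p)) / ((F (b t) - p) - (F (a t) - p))"
    using Fa w by (simp add: max_price_slope_def Let_def a_def b_def algebra_simps)
  ultimately show ?thesis by (simp add: has_field_derivative_iff)
qed

lemma free_price_deriv:
  "\<exists>S. finite S \<and> (\<forall>t>0. t \<notin> S \<longrightarrow>
     (free_price has_real_derivative max_price_slope p \<nu> t (free_price t)) (at t))"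
proof (intro exI conjI allI impI)
  let ?S = "{t. 0 \<le> t \<and> free_price t - t = q0 \<and> (\<forall>s>t. free_price s - s \<noteq> q0)} \<union>
    {t. 0 \<le> t \<and> free_price t - t < q0 \<and> measure \<nu> {free_price t - t} \<noteq> 0} \<union>
    {t. 0 \<le> t \<and> free_price t - t < q0 \<and> measure \<nu> {free_price t + t} \<noteq> 0}"
  show "finite ?S" by (intro finite_UnI finite_free_price_exceptional)
  fix t :: real assume t: "0 < t" "t \<notin> ?S"
  show "(free_price has_real_derivative max_price_slope p \<nu> t (free_price t)) (at t)"
  proof (cases "free_price t - t = q0")
    case True
    then obtain s where "t < s" "free_price s - s = q0" using t by auto
    then show ?thesis using free_price_deriv_flat t by blast
  next
    case False
    then have "free_price t - t < q0" using free_price(1)[of t] t by simp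
    then show ?thesis using t by (intro free_price_deriv_regular) auto
  qed
qed

section \<open>Crossing 0 or 1 is irreversible for the free price\<close>

text \<open>
  For \<open>s > 0\<close> the function \<open>s \<mapsto> excess (1 + s) - excess (1 - s)\<close> is concave and vanishes at \<open>0\<close>, so once
  nonpositive it stays so. At the other end \<open>s \<mapsto> excess s - excess (- s)\<close> is convex.
\<close>

lemma free_price_ge_1:
  assumes s: "0 \<le> s" "1 \<le> free_price s" and t: "s \<le> t"
  shows "1 \<le> free_price t"
proof (rule ccontr)
  assume neg: "\<not> ?thesis"
  have s0: "0 < s" using s free_price_0 quantile_bounds by (cases "s = 0") auto
  have st: "s < t" using neg s t by (cases "s = t") auto
  note fs = free_price[OF s(1)] and ft = free_price[of t]
  \<comment> \<open>The number \<open>c + (1 - p)\<close> is the left derivative at \<open>s\<close>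
    of the concave function. It bounds the chord to 0 from below, hence is nonpositive, and bounds
    the chord to \<open>t\<close> from above.\<close>
  define c where "c = F (1 - s) - p"
  have "excess (1 + s) \<le> excess (free_price s + s)"
    using s quantile_bounds by (intro excess_mono) auto
  also have "\<dots> \<le> excess (1 - s)"
    unfolding fs(3) using s fs(1) by (intro excess_antimono) auto
  finally have gs: "excess (1 + s) \<le> excess (1 - s)" .
  have "s * c \<le> excess 1 - excess (1 - s)"
    using excess_diff_ge[of "1 - s" 1] s by (simp add: c_def)
  moreover have "s * (1 - p) \<le> excess (1 + s) - excess 1"
    using excess_diff_ge[of 1 "1 + s"] cdf_eq_1[of 1] s by simp
  ultimately have "s * (c + (1 - p)) \<le> 0" using gs by (simp add: algebra_simps)
  then have "c + (1 - p) \<le> 0" using s0 by (simp add: mult_le_0_iff)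
  then have c: "(t - s) * c + (t - s) * (1 - p) \<le> 0"
    using st mult_nonneg_nonpos[of "t - s" "c + (1 - p)"] by (simp add: algebra_simps)
  have "excess (1 - s) - excess (1 - t) \<le> (t - s) * c"
    using excess_diff_le_cdf[of "1 - t" "1 - s"] st by (simp add: c_def)
  moreover have "excess (1 + t) - excess (1 + s) \<le> (t - s) * (1 - p)"
    using excess_diff_le_cdf[of "1 + s" "1 + t"] cdf_eq_1[of "1 + t"] st s0 by simp
  ultimately have "excess (1 + t) \<le> excess (1 - t)" using gs c by simp
  moreover have "excess (free_price t + t) \<le> excess (1 + t)"
    using neg ft(2) st s by (intro excess_mono) auto
  moreover have "excess (1 - t) < excess (free_price t - t)"
    using neg st s fs(1) by (intro excess_strict_antimono) auto
  ultimately show False using ft(3) st s by simp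
qed

lemma free_price_le_0:
  assumes s: "0 \<le> s" "free_price s \<le> 0" and t: "s \<le> t"
  shows "free_price t \<le> 0"
proof (rule ccontr)
  assume neg: "\<not> ?thesis"
  have s0: "0 < s" using s free_price_0 quantile_bounds by (cases "s = 0") auto
  have st: "s < t" using neg s t by (cases "s = t") auto
  note fs = free_price[OF s(1)] and ft = free_price[of t]
  \<comment> \<open>Likewise \<open>c - p\<close> is a slope at \<open>s\<close> of the convex
    function; the chord to 0 shows that it is nonnegative.\<close>
  define c where "c = F s - p"
  have "excess (- s) \<le> excess (free_price s - s)"
    using s quantile_bounds by (intro excess_antimono) auto
  also have "\<dots> \<le> excess s"
    unfolding fs(3)[symmetric] using s fs(2) by (intro excess_mono) auto
  finally have gs: "excess (- s) \<le> excess s" .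
  have "s * p \<le> excess (- s) - excess 0"
    using excess_diff_le[of "- s" 0] cdf_left_eq_0[of 0] s by simp
  moreover have "excess s - excess 0 \<le> s * c"
    using excess_diff_le_cdf[of 0 s] s by (simp add: c_def)
  ultimately have "s * p \<le> s * c" using gs by simp
  then have "p \<le> c" using s0 by simp
  then have c: "(t - s) * p \<le> (t - s) * c" using st by simp
  have "(t - s) * c \<le> excess t - excess s"
    using excess_diff_ge[of s t] st by (simp add: c_def)
  moreover have "- ((t - s) * p) \<le> excess (- s) - excess (- t)"
    using excess_diff_ge[of "- t" "- s"] cdf_eq_0[of "- t"] s st by simp
  ultimately have "excess (- t) \<le> excess t" using gs c by simp
  moreover have "excess t \<le> excess (free_price t + t)"
    using neg fs(2) st s by (intro excess_mono) auto
  moreover have "excess (free_price t - t) < excess (- t)"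
    using neg st s ft(1) by (intro excess_strict_antimono) auto
  ultimately show False using ft(3) st s by simp
qed

subsection \<open>Existence and the explicit solution\<close>

text \<open>The infima are the first hitting times of 1 and 0, where truncation can produce a kink.
  Elsewhere the truncated price is locally constant or locally the free price. If a set is empty,
  its \<open>Inf\<close> merely excludes one more point.\<close>

lemma clipped_deriv:
  assumes t: "0 < t" "t \<noteq> Inf {s. 0 \<le> s \<and> 1 \<le> free_price s}" "t \<noteq> Inf {s. 0 \<le> s \<and> free_price s \<le> 0}"
    and deriv: "(free_price has_real_derivative max_price_slope p \<nu> t (free_price t)) (at t)"
  defines "q \<equiv> \<lambda>t. min 1 (max 0 (free_price t))"
  shows "(q has_real_derivative max_price_slope p \<nu> t (q t) * indicator {0<..<1} (q t)) (at t)"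
proof -
  consider (one) "1 \<le> free_price t" | (zero) "free_price t \<le> 0" | (inside) "0 < free_price t" "free_price t < 1"
    by linarith
  then show ?thesis
  proof cases
    case one
    have "Inf {s. 0 \<le> s \<and> 1 \<le> free_price s} \<le> t"
      using t one by (intro cInf_lower) (auto intro!: bdd_belowI)
    with t have "Inf {s. 0 \<le> s \<and> 1 \<le> free_price s} < t" by simp
    moreover have "{s. 0 \<le> s \<and> 1 \<le> free_price s} \<noteq> {}" using t one less_imp_le by blast
    ultimately obtain s where s: "0 \<le> s" "1 \<le> free_price s" "s < t"
      using cInf_lessD[of "{s. 0 \<le> s \<and> 1 \<le> free_price s}" t] by blast
    have "((\<lambda>_. 1) has_real_derivative 0) (at t)" by simp
    then have "(q has_real_derivative 0) (at t)"
    proof (rule has_field_derivative_transform_within_open)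
      show "1 = q r" if "r \<in> {s<..}" for r
        using free_price_ge_1[OF s(1,2), of r] that by (simp add: q_def)
    qed (use s in auto)
    moreover have "q t = 1" using one by (simp add: q_def)
    ultimately show ?thesis by simp
  next
    case zero
    have "Inf {s. 0 \<le> s \<and> free_price s \<le> 0} \<le> t"
      using t zero by (intro cInf_lower) (auto intro!: bdd_belowI)
    with t have "Inf {s. 0 \<le> s \<and> free_price s \<le> 0} < t" by simp
    moreover have "{s. 0 \<le> s \<and> free_price s \<le> 0} \<noteq> {}" using t zero less_imp_le by blast
    ultimately obtain s where s: "0 \<le> s" "free_price s \<le> 0" "s < t"
      using cInf_lessD[of "{s. 0 \<le> s \<and> free_price s \<le> 0}" t] by blast
    have "((\<lambda>_. 0) has_real_derivative 0) (at t)" by simp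
    then have "(q has_real_derivative 0) (at t)"
    proof (rule has_field_derivative_transform_within_open)
      show "0 = q r" if "r \<in> {s<..}" for r
        using free_price_le_0[OF s(1,2), of r] that by (simp add: q_def)
    qed (use s in auto)
    moreover have "q t = 0" using zero by (simp add: q_def)
    ultimately show ?thesis by simp
  next
    case inside
    define d where "d = min t (min (free_price t) (1 - free_price t))"
    have d: "0 < d" "d \<le> t" "d \<le> free_price t" "d \<le> 1 - free_price t" using inside t by (auto simp: d_def)
    have "(q has_real_derivative max_price_slope p \<nu> t (free_price t)) (at t)"
      using deriv
    proof (rule has_field_derivative_transform_within_open)
      show "free_price r = q r" if "r \<in> ball t d" for r
      proof -
        have "\<bar>r - t\<bar> < d" using that by (simp add: dist_real_def abs_minus_commute)
        then have "\<bar>free_price r - free_price t\<bar> < d"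
          using free_price_lipschitz'[of t r] t d(2) by linarith
        then show ?thesis using d by (simp add: q_def)
      qed
    qed (use d in auto)
    moreover have "q t = free_price t" using inside by (simp add: q_def)
    ultimately show ?thesis using inside by simp
  qed
qed

lemma solves_clipped: "solves_max_price_ode p \<nu> (\<lambda>t. min 1 (max 0 (free_price t)))"
  unfolding solves_max_price_ode_def
proof (intro conjI allI impI)
  let ?q = "\<lambda>t. min 1 (max 0 (free_price t))"
  let ?v = "\<lambda>s. max_price_slope p \<nu> s (?q s) * indicator {0<..<1} (?q s)"
  show "?q 0 = quantile \<nu> p" using quantile_bounds by (simp add: free_price_0)
  fix t :: real assume t: "0 \<le> t"
  obtain S where S: "finite S" "\<And>t. 0 < t \<Longrightarrow> t \<notin> S \<Longrightarrow>
     (free_price has_real_derivative max_price_slope p \<nu> t (free_price t)) (at t)"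
    using free_price_deriv by blast
  let ?S = "S \<union> {Inf {s. 0 \<le> s \<and> 1 \<le> free_price s}, Inf {s. 0 \<le> s \<and> free_price s \<le> 0}}"
  show "(?v has_integral (?q t - ?q 0)) {0..t}"
  proof (rule fundamental_theorem_of_calculus_interior_strong[where S="?S"])
    show "finite ?S" using S by simp
    show "(?q has_vector_derivative ?v r) (at r)" if "r \<in> {0<..<t} - ?S" for r
      unfolding has_real_derivative_iff_has_vector_derivative[symmetric]
      using that by (intro clipped_deriv S) auto
    have "continuous_on {0..t} free_price"
      by (rule lipschitz_on_continuous_on[of 1], rule lipschitz_onI)
        (auto simp: dist_real_def intro: free_price_lipschitz')
    then show "continuous_on {0..t} ?q" by (intro continuous_intros)
  qed (rule t)
qed

lemma max_price_evolution_eq: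
  assumes "0 \<le> t" shows "max_price_evolution p \<nu> t = min 1 (max 0 (free_price t))"
proof -
  let ?q = "\<lambda>t. min 1 (max 0 (free_price t))"
  \<comment> \<open>The equation sees only nonnegative times, so the extensional restriction
    demanded by \<open>max_price_evolution\<close> is again a solution.\<close>
  have cong: "solves_max_price_ode p \<nu> r" if "solves_max_price_ode p \<nu> q" "\<And>t. 0 \<le> t \<Longrightarrow> r t = q t" for q r
    unfolding solves_max_price_ode_def
  proof (intro conjI allI impI)
    show "r 0 = quantile \<nu> p" using solution_0[OF that(1)] that(2)[of 0] by simp
    fix t :: real assume "0 \<le> t"
    then have "((\<lambda>s. max_price_slope p \<nu> s (q s) * indicator {0<..<1} (q s)) has_integral (r t - r 0)) {0..t}"
      using solution_has_integral[OF that(1), of 0 t] that(2) by simp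
    then show "((\<lambda>s. max_price_slope p \<nu> s (r s) * indicator {0<..<1} (r s)) has_integral (r t - r 0)) {0..t}"
      by (rule has_integral_eq[rotated]) (simp add: that(2))
  qed
  have sol: "solves_max_price_ode p \<nu> (restrict ?q {0..})"
    by (rule cong[OF solves_clipped]) simp
  have "max_price_evolution p \<nu> = restrict ?q {0..}"
    unfolding max_price_evolution_def
  proof (rule the_equality)
    show "restrict ?q {0..} \<in> extensional {0..} \<and> solves_max_price_ode p \<nu> (restrict ?q {0..})"
      using sol by simp
    fix r assume r: "r \<in> extensional {0..} \<and> solves_max_price_ode p \<nu> r"
    show "r = restrict ?q {0..}"
    proof (rule extensionalityI[of _ "{0..}"])
      fix s :: real assume "s \<in> {0..}"
      then show "r s = restrict ?q {0..} s"
        using solution_le[OF sol, of r s] solution_le[OF _ sol, of r s] r by (intro antisym) auto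
    qed (use r in auto)
  qed
  then show ?thesis using assms by simp
qed

section \<open>The free price as a sign change of a mean\<close>

definition imbalance :: "real \<Rightarrow> real \<Rightarrow> real" where
  "imbalance t y = excess (y + t) - excess (y - t)"

text \<open>In this form the measure enters only through the integral of a function with values in
  \<open>[0, 2 * t]\<close>, to which the law of large numbers applies.\<close>

lemma imbalance_eq: "imbalance t y = (\<integral>b. max 0 (y + t - b) - max 0 (y - t - b) \<partial>\<nu>) - 2 * p * t"
  unfolding imbalance_def excess_diff by (simp add: algebra_simps)

lemma imbalance_mono: assumes "0 \<le> t" "x \<le> y" shows "imbalance t x \<le> imbalance t y"
proof -
  have "(\<integral>b. max 0 (x + t - b) - max 0 (x - t - b) \<partial>\<nu>) \<le> (\<integral>b. max 0 (y + t - b) - max 0 (y - t - b) \<partial>\<nu>)"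
    by (intro integral_mono integrable_call_spread) (use assms in auto)
  then show ?thesis by (simp add: imbalance_eq)
qed

lemma imbalance_free_price: "0 \<le> t \<Longrightarrow> imbalance t (free_price t) = 0"
  using free_price(3)[of t] by (simp add: imbalance_def)

lemma free_price_less: "0 \<le> t \<Longrightarrow> 0 < imbalance t y \<Longrightarrow> free_price t < y"
  using imbalance_mono[of t y "free_price t"] imbalance_free_price[of t] by force

lemma less_free_price: "0 \<le> t \<Longrightarrow> imbalance t y < 0 \<Longrightarrow> y < free_price t"
  using imbalance_mono[of t "free_price t" y] imbalance_free_price[of t] by force

text \<open>Strictness comes from the left branch, where \<open>excess\<close> is always strictly
  decreasing.\<close>

lemma imbalance_neg: assumes "0 < t" "y < free_price t" shows "imbalance t y < 0"
proof (cases "y + t \<le> q0")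
  case True
  then show ?thesis
    unfolding imbalance_def using excess_strict_antimono[of "y - t" "y + t"] assms by simp
next
  case False
  have "excess (free_price t - t) < excess (y - t)"
    using free_price(1)[of t] assms by (intro excess_strict_antimono) auto
  moreover have "excess (y + t) \<le> excess (free_price t + t)"
    using False assms by (intro excess_mono) auto
  ultimately show ?thesis unfolding imbalance_def using free_price(3)[of t] assms by simp
qed

text \<open>If the left end is below \<open>q0\<close>, the left branch again gives strictness. If
  it rests at \<open>q0\<close>, both ends move right of \<open>q0\<close>, where
  \<open>excess\<close> may be flat; the hypothesis on the level makes it rise beyond
  \<open>q0 + 2 * t\<close>.\<close>

lemma imbalance_pos:
  assumes t: "0 < t" and y: "free_price t < y"
    and level: "\<And>x. q0 + 2 * t < x \<Longrightarrow> p < F x"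
  shows "0 < imbalance t y"
proof (cases "free_price t - t = q0")
  case True
  \<comment> \<open>By monotonicity a closer point suffices. The cap keeps \<open>z - t\<close> at
    or below \<open>q0 + 2 * t\<close>, and \<open>m\<close> lies strictly between that point and
    \<open>z + t\<close>.\<close>
  define z where "z = min y (q0 + 3 * t)"
  have z: "q0 + t < z" "z \<le> y" "z \<le> q0 + 3 * t" using True y t by (auto simp: z_def)
  define m where "m = (q0 + 2 * t + (z + t)) / 2"
  have m: "q0 + 2 * t < m" "m < z + t" using z by (auto simp: m_def)
  have "excess (z - t) \<le> excess (q0 + 2 * t)"
    using z by (intro excess_mono) auto
  also have "\<dots> \<le> excess m"
    using m t by (intro excess_mono) auto
  also have "\<dots> < excess (z + t)"
    using m t level[OF m(1)] by (intro excess_strict_mono) auto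
  finally have "0 < imbalance t z" by (simp add: imbalance_def)
  then show ?thesis using imbalance_mono[of t z y] z t by simp
next
  case False
  define z where "z = min y (q0 + t)"
  have z: "free_price t < z" "z \<le> y" "z \<le> q0 + t" using False y free_price(1)[of t] t by (auto simp: z_def)
  have "excess (z - t) < excess (free_price t - t)"
    using z by (intro excess_strict_antimono) auto
  moreover have "excess (free_price t + t) \<le> excess (z + t)"
    using z free_price(2)[of t] t by (intro excess_mono) auto
  ultimately have "0 < imbalance t z" unfolding imbalance_def using free_price(3)[of t] t by simp
  then show ?thesis using imbalance_mono[of t z y] z t by simp
qed

end

subsection \<open>Empirical measures\<close>

lemma (in prob_space) strong_law_of_large_numbers_bounded:
  fixes X :: "nat \<Rightarrow> 'a \<Rightarrow> real"
  assumes indep: "indep_vars (\<lambda>_. borel) X {1..}"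
    and bounded: "\<And>i. 1 \<le> i \<Longrightarrow> AE \<omega> in M. X i \<omega> \<in> {a..b}" and ab: "a < b"
    and mean: "\<And>i. 1 \<le> i \<Longrightarrow> expectation (X i) = m"
  shows "AE \<omega> in M. (\<lambda>n. (\<Sum>i=1..n. X i \<omega>) / real n) \<longlonglongrightarrow> m"
proof -
  have [measurable]: "random_variable borel (X i)" if "1 \<le> i" for i
    using indep that by (auto simp: indep_vars_def)
  define A where "A e n = {\<omega> \<in> space M. real n * e \<le> \<bar>(\<Sum>i=1..n. X i \<omega>) - real n * m\<bar>}" for e n
  have [measurable]: "A e n \<in> events" for e n
    unfolding A_def by measurable
  have bound: "prob (A e n) \<le> 2 * exp (- 2 * e\<^sup>2 / (b - a)\<^sup>2) ^ n" if "1 \<le> n" "0 < e" for e n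
  proof -
    interpret Hoeffding_ineq M "{1..n}" X "\<lambda>_. a" "\<lambda>_. b" "\<Sum>i\<in>{1..n}. expectation (X i)"
      by unfold_locales (use bounded in \<open>auto intro: indep_vars_subset[OF indep]\<close>)
    have "prob (A e n) \<le> 2 * exp (- 2 * (real n * e)\<^sup>2 / (\<Sum>i\<in>{1..n}. (b - a)\<^sup>2))"
      using Hoeffding_ineq_abs_ge[of "real n * e"] ab that mean by (simp add: A_def)
    \<comment> \<open>The exponent is linear in \<open>n\<close>, so the tail bounds form a
      geometric series.\<close>
    also have "- 2 * (real n * e)\<^sup>2 / (\<Sum>i\<in>{1..n}. (b - a)\<^sup>2) = real n * (- 2 * e\<^sup>2 / (b - a)\<^sup>2)"
      by (simp add: power_mult_distrib power2_eq_square[of "real n"])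
    also have "exp \<dots> = exp (- 2 * e\<^sup>2 / (b - a)\<^sup>2) ^ n" by (rule exp_of_nat_mult)
    finally show ?thesis .
  qed
  have "AE \<omega> in M. \<forall>k. eventually (\<lambda>n. \<omega> \<in> space M - A (1 / real (Suc k)) n) sequentially"
    unfolding AE_all_countable
  proof
    fix k
    let ?e = "1 / real (Suc k)"
    have "summable (\<lambda>n. 2 * exp (- 2 * ?e\<^sup>2 / (b - a)\<^sup>2) ^ n)"
      using ab by (intro summable_mult summable_geometric) simp
    then have "summable (\<lambda>n. prob (A ?e n))"
      by (rule summable_comparison_test'[where N=1]) (use bound in simp)
    then show "AE \<omega> in M. eventually (\<lambda>n. \<omega> \<in> space M - A ?e n) sequentially"
      by (intro borel_cantelli_AE1) (simp_all add: emeasure_eq_measure)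
  qed
  then show ?thesis
  proof eventually_elim
    case (elim \<omega>)
    show ?case
    proof (rule LIMSEQ_I)
      fix r :: real assume "0 < r"
      then obtain k where k: "1 / real (Suc k) < r" using nat_approx_posE by blast
      have "eventually (\<lambda>n. norm ((\<Sum>i=1..n. X i \<omega>) / real n - m) < r) sequentially"
        using elim[rule_format, of k] eventually_gt_at_top[of 0]
      proof eventually_elim
        case (elim n)
        then have "\<bar>(\<Sum>i=1..n. X i \<omega>) - real n * m\<bar> < real n * (1 / real (Suc k))"
          by (simp add: A_def not_le)
        also have "\<dots> \<le> real n * r" using k by (intro mult_left_mono) auto
        finally have "\<bar>(\<Sum>i=1..n. X i \<omega>) - real n * m\<bar> / real n < r"
          using elim by (simp add: divide_less_eq mult.commute)
        moreover have "(\<Sum>i=1..n. X i \<omega>) / real n - m = ((\<Sum>i=1..n. X i \<omega>) - real n * m) / real n"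
          using elim by (simp add: field_simps)
        ultimately show ?case by (simp add: abs_divide)
      qed
      then show "\<exists>no. \<forall>n\<ge>no. norm ((\<Sum>i=1..n. X i \<omega>) / real n - m) < r"
        by (simp add: eventually_sequentially)
    qed
  qed
qed

text \<open>Countably many thresholds determine a limit, so one null set can serve them all.\<close>

lemma tendsto_Rats:
  fixes x :: "'a \<Rightarrow> real"
  assumes upper: "\<And>y. y \<in> \<rat> \<Longrightarrow> l < y \<Longrightarrow> eventually (\<lambda>n. x n \<le> y) F"
    and lower: "\<And>y. y \<in> \<rat> \<Longrightarrow> y < l \<Longrightarrow> eventually (\<lambda>n. y \<le> x n) F"
  shows "(x \<longlongrightarrow> l) F"
proof (rule order_tendstoI)
  fix a assume "l < a"
  then obtain y where "y \<in> \<rat>" "l < y" "y < a" using Rats_dense_in_real by blast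
  then show "eventually (\<lambda>n. x n < a) F" by (intro eventually_mono[OF upper[of y]]) auto
next
  fix a assume "a < l"
  then obtain y where "y \<in> \<rat>" "a < y" "y < l" using Rats_dense_in_real by blast
  then show "eventually (\<lambda>n. a < x n) F" by (intro eventually_mono[OF lower[of y]]) auto
qed

lemma measurable_uniform_count_measure: "x \<in> uniform_count_measure I \<rightarrow>\<^sub>M borel"
  by (simp add: measurable_def space_uniform_count_measure sets_uniform_count_measure)

text \<open>Seen as the law of \<open>x\<close> at a uniformly chosen index, the empirical measure
  inherits the facts on image measures.\<close>

lemma empirical_measure_eq_distr:
  assumes "1 \<le> n"
  shows "empirical_measure n x = distr (uniform_count_measure {1..n}) borel x"
proof (rule measure_eqI)
  fix A assume "A \<in> sets (empirical_measure n x)"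
  then have A: "A \<in> sets borel" by simp
  have "emeasure (distr (uniform_count_measure {1..n}) borel x) A =
      emeasure (uniform_count_measure {1..n}) {i \<in> {1..n}. x i \<in> A}"
    by (subst emeasure_distr[OF measurable_uniform_count_measure A]) (auto simp: space_uniform_count_measure intro!: arg_cong2[where f=emeasure])
  also have "\<dots> = ennreal (real (card {i \<in> {1..n}. x i \<in> A}) / real n)"
    by (subst emeasure_uniform_count_measure) auto
  also have "\<dots> = ennreal (1 / real n) * (\<Sum>i\<in>{1..n}. indicator A (x i))"
  proof -
    have "(\<Sum>i\<in>{1..n}. indicator A (x i) :: ennreal) = of_nat (card {i \<in> {1..n}. x i \<in> A})"
      by (simp add: indicator_def sum.If_cases Int_def)
    then show ?thesis by (simp add: ennreal_mult[symmetric] ennreal_of_nat_eq_real_of_nat)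
  qed
  also have "\<dots> = emeasure (empirical_measure n x) A"
    using A by (simp add: emeasure_empirical_measure)
  finally show "emeasure (empirical_measure n x) A = emeasure (distr (uniform_count_measure {1..n}) borel x) A"
    by simp
qed simp

lemma integral_empirical_measure:
  fixes h :: "real \<Rightarrow> real"
  assumes "1 \<le> n" "h \<in> borel_measurable borel"
  shows "(\<integral>b. h b \<partial>empirical_measure n x) = (\<Sum>i=1..n. h (x i)) / real n"
  unfolding empirical_measure_eq_distr[OF assms(1)]
  by (subst integral_distr[OF measurable_uniform_count_measure assms(2)])
     (simp add: integral_uniform_count_measure)

lemma measure_empirical_measure:
  assumes "1 \<le> n" "A \<in> sets borel"
  shows "measure (empirical_measure n x) A = (\<Sum>i=1..n. indicator A (x i)) / real n"
  using integral_empirical_measure[OF assms(1), of "indicator A" x] assms(2) by simp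

lemma max_price_empirical_measure:
  assumes p: "0 < p" "p < 1" and n: "1 \<le> n" and x: "\<And>i. 1 \<le> i \<Longrightarrow> i \<le> n \<Longrightarrow> 0 < x i \<and> x i < 1"
  shows "max_price (empirical_measure n x) p"
proof -
  have "prob_space (uniform_count_measure {1..n})"
    using n by (intro prob_space_uniform_count_measure) auto
  then interpret prob_space "empirical_measure n x"
    unfolding empirical_measure_eq_distr[OF n]
    by (rule prob_space.prob_space_distr[OF _ measurable_uniform_count_measure])
  show ?thesis
  proof unfold_locales
    have "(\<Sum>i=1..n. indicator {0<..<1} (x i)) = (\<Sum>i=1..n. 1 :: real)"
      by (rule sum.cong) (use x in auto)
    then show "prob {0<..<1} = 1" using n by (simp add: measure_empirical_measure)
    have "prob {y} = 0" if "y \<notin> x ` {1..n}" for y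
    proof -
      have "(\<Sum>i=1..n. indicator {y} (x i)) = (\<Sum>i=1..n. 0 :: real)"
        by (rule sum.cong) (use that in \<open>auto simp: indicator_def\<close>)
      then show ?thesis using n by (simp add: measure_empirical_measure)
    qed
    then have "{y. prob {y} \<noteq> 0} \<subseteq> x ` {1..n}" by blast
    then show "finite {y. prob {y} \<noteq> 0}" by (rule finite_subset) simp
  qed (use p in auto)
qed

lemma max_price_density:
  assumes p: "0 < p" "p < 1" and f: "f \<in> borel_measurable borel"
    and \<mu>: "\<mu> = density lborel (\<lambda>x. ennreal (f x))" "prob_space \<mu>" "measure \<mu> {0..1} = 1"
  shows "max_price \<mu> p"
proof -
  interpret prob_space \<mu> by fact
  have sets: "sets \<mu> = sets borel" by (simp add: \<mu>)
  have null: "measure \<mu> {x} = 0" for x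
  proof -
    have "emeasure \<mu> {x} = (\<integral>\<^sup>+y. ennreal (f y) * indicator {x} y \<partial>lborel)"
      unfolding \<mu>(1) by (rule emeasure_density) (use f in auto)
    also have "\<dots> = (\<integral>\<^sup>+(y::real). 0 \<partial>lborel)"
      by (rule nn_integral_cong_AE) (use AE_lborel_singleton[of x] in \<open>auto elim!: eventually_mono\<close>)
    finally show ?thesis by (simp add: measure_def)
  qed
  have "{0..1::real} = {0<..<1} \<union> {0} \<union> {1}" by auto
  then have "measure \<mu> {0..1} \<le> measure \<mu> {0<..<1} + measure \<mu> {0} + measure \<mu> {1}"
    by (simp only:) (intro order_trans[OF measure_Un_le] add_mono order_refl; simp add: sets)
  then have "measure \<mu> {0<..<1} = 1" using null \<mu>(3) prob_le_1[of "{0<..<1}"] by simp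
  then show ?thesis
    by unfold_locales (use p sets null in auto)
qed

lemma (in max_price) max_price_evolution_0: "max_price_evolution p \<nu> 0 = quantile \<nu> p"
  using quantile_bounds by (simp add: max_price_evolution_eq free_price_0)

subsection \<open>Convergence\<close>

text \<open>This serves \<open>t = 0\<close>, where the imbalance vanishes identically and the cdf
  takes its place.\<close>

lemma quantile_tendsto:
  assumes \<mu>: "max_price \<mu> p" and N: "eventually (\<lambda>n. max_price (N n) p) sequentially"
    and level: "\<And>x. quantile \<mu> p < x \<Longrightarrow> p < cdf \<mu> x"
    and lim: "\<And>y. y \<in> \<rat> \<Longrightarrow> (\<lambda>n. cdf (N n) y) \<longlonglongrightarrow> cdf \<mu> y"
  shows "(\<lambda>n. quantile (N n) p) \<longlonglongrightarrow> quantile \<mu> p"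
proof (rule tendsto_Rats)
  interpret max_price \<mu> p by fact
  fix y :: real assume y: "y \<in> \<rat>"
  show "eventually (\<lambda>n. quantile (N n) p \<le> y) sequentially" if "quantile \<mu> p < y"
    using N order_tendstoD(1)[OF lim[OF y] level[OF that]]
  proof eventually_elim
    case (elim n)
    then show ?case using max_price.quantile_le[of "N n" p y] that quantile_bounds by simp
  qed
  show "eventually (\<lambda>n. y \<le> quantile (N n) p) sequentially" if "y < quantile \<mu> p"
    using N order_tendstoD(2)[OF lim[OF y] cdf_less[OF that]]
  proof eventually_elim
    case (elim n)
    then show ?case using max_price.le_cdf[of "N n" p y] by force
  qed
qed

text \<open>At a rational \<open>y\<close> off the limit price the imbalance of \<mu> has a strict
  sign, which those of \<open>N n\<close> eventually share; this places their free prices on the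
  right side of \<open>y\<close>.\<close>

lemma free_price_tendsto:
  assumes \<mu>: "max_price \<mu> p" and N: "eventually (\<lambda>n. max_price (N n) p) sequentially" and t: "0 < t"
    and level: "\<And>x. quantile \<mu> p + 2 * t < x \<Longrightarrow> p < cdf \<mu> x"
    and lim: "\<And>y. y \<in> \<rat> \<Longrightarrow> (\<lambda>n. \<integral>b. max 0 (y + t - b) - max 0 (y - t - b) \<partial>N n)
      \<longlonglongrightarrow> (\<integral>b. max 0 (y + t - b) - max 0 (y - t - b) \<partial>\<mu>)"
  shows "(\<lambda>n. max_price.free_price (N n) p t) \<longlonglongrightarrow> max_price.free_price \<mu> p t"
proof -
  interpret max_price \<mu> p by fact
  have lim': "(\<lambda>n. max_price.imbalance (N n) p t y) \<longlonglongrightarrow> imbalance t y" if "y \<in> \<rat>" for y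
  proof (rule Lim_transform_eventually)
    show "(\<lambda>n. (\<integral>b. max 0 (y + t - b) - max 0 (y - t - b) \<partial>N n) - 2 * p * t) \<longlonglongrightarrow> imbalance t y"
      unfolding imbalance_eq by (intro tendsto_intros lim that)
    show "\<forall>\<^sub>F n in sequentially. (\<integral>b. max 0 (y + t - b) - max 0 (y - t - b) \<partial>N n) - 2 * p * t
        = max_price.imbalance (N n) p t y"
      using N by eventually_elim (simp add: max_price.imbalance_eq)
  qed
  show ?thesis
  proof (rule tendsto_Rats)
    fix y :: real assume y: "y \<in> \<rat>"
    show "eventually (\<lambda>n. max_price.free_price (N n) p t \<le> y) sequentially" if y': "free_price t < y"
    proof -
      have "0 < imbalance t y" using t y' level by (rule imbalance_pos)
      from N order_tendstoD(1)[OF lim'[OF y] this] show ?thesis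
        by eventually_elim (use t max_price.free_price_less in \<open>force intro: less_imp_le\<close>)
    qed
    show "eventually (\<lambda>n. y \<le> max_price.free_price (N n) p t) sequentially" if y': "y < free_price t"
      using N order_tendstoD(2)[OF lim'[OF y] imbalance_neg[OF t y']]
      by eventually_elim (use t max_price.less_free_price in \<open>force intro: less_imp_le\<close>)
  qed
qed

lemma (in prob_space) AE_empirical_integral_tendsto:
  fixes h :: "real \<Rightarrow> real"
  assumes indep: "indep_vars (\<lambda>_. borel) b {1..}" and law: "\<And>i. 1 \<le> i \<Longrightarrow> distr M borel (b i) = \<mu>"
    and h: "h \<in> borel_measurable borel" and bounds: "\<And>x. u \<le> h x" "\<And>x. h x \<le> v" and uv: "u < v"
  shows "AE \<omega> in M. (\<lambda>n. \<integral>x. h x \<partial>empirical_measure n (\<lambda>i. b i \<omega>)) \<longlonglongrightarrow> (\<integral>x. h x \<partial>\<mu>)"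
proof -
  have rv: "random_variable borel (b i)" if "1 \<le> i" for i
    using indep that by (auto simp: indep_vars_def)
  have "AE \<omega> in M. (\<lambda>n. (\<Sum>i=1..n. h (b i \<omega>)) / real n) \<longlonglongrightarrow> (\<integral>x. h x \<partial>\<mu>)"
  proof (rule strong_law_of_large_numbers_bounded[OF _ _ uv])
    show "indep_vars (\<lambda>_. borel) (\<lambda>i \<omega>. h (b i \<omega>)) {1..}"
      by (rule indep_vars_compose2[OF indep]) (use h in simp)
    show "expectation (\<lambda>\<omega>. h (b i \<omega>)) = (\<integral>x. h x \<partial>\<mu>)" if "1 \<le> i" for i
      unfolding law[OF that, symmetric] by (rule integral_distr[OF rv[OF that] h, symmetric])
  qed (use bounds in auto)
  then show ?thesis
  proof eventually_elim
    case (elim \<omega>)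
    then show ?case
    proof (rule Lim_transform_eventually)
      show "\<forall>\<^sub>F n in sequentially. (\<Sum>i=1..n. h (b i \<omega>)) / real n = (\<integral>x. h x \<partial>empirical_measure n (\<lambda>i. b i \<omega>))"
        using eventually_ge_at_top[of 1] by eventually_elim (simp add: integral_empirical_measure h)
    qed
  qed
qed

text \<open>The hypothesis \<open>level\<close> pins the limit down: if the cdf stayed at
  \<open>p\<close> from the quantile to some point beyond \<open>quantile \<mu> p + 2 * t\<close>,
  the imbalance of \<mu> would vanish on an interval right of the free price. For
  \<open>t = 0\<close> it says that the quantile is the only point at which the cdf crosses
  \<open>p\<close>.\<close>

theorem theorem5p1:
  fixes M :: "'a measure" and b :: "nat \<Rightarrow> 'a \<Rightarrow> real"
    and \<mu> :: "real measure" and f :: "real \<Rightarrow> real" and p t :: real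
  assumes p: "0 < p" "p < 1"
    and f: "f \<in> borel_measurable borel" "\<And>x. 0 \<le> f x"
    and \<mu>: "\<mu> = density lborel (\<lambda>x. ennreal (f x))" "prob_space \<mu>" "measure \<mu> {0..1} = 1"
    and M: "prob_space M"
    and indep: "prob_space.indep_vars M (\<lambda>_. borel) b {1..}"
    and law: "\<And>i. 1 \<le> i \<Longrightarrow> distr M borel (b i) = \<mu>"
    and t: "0 \<le> t"
    and level: "\<And>x. quantile \<mu> p + 2 * t < x \<Longrightarrow> p < cdf \<mu> x"
  shows "AE \<omega> in M. (\<lambda>n. max_price_evolution p (empirical_measure n (\<lambda>i. b i \<omega>)) t)
           \<longlonglongrightarrow> max_price_evolution p \<mu> t"
proof -
  interpret prob_space M by fact
  have mp: "max_price \<mu> p" using max_price_density[OF p f(1) \<mu>] .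
  have rv: "random_variable borel (b i)" if "1 \<le> i" for i
    using indep that by (auto simp: indep_vars_def)
  \<comment> \<open>Almost surely no bid is 0 or 1, which brings the empirical measures into the
    locale.\<close>
  have "AE \<omega> in M. 1 \<le> i \<longrightarrow> 0 < b i \<omega> \<and> b i \<omega> < 1" for i
  proof (cases "1 \<le> i")
    case True
    have "AE x in distr M borel (b i). 0 < x \<and> x < 1"
      unfolding law[OF True] by (rule max_price.AE_carrier[OF mp])
    then show ?thesis by (subst (asm) AE_distr_iff[OF rv[OF True]]) auto
  qed simp
  then have "AE \<omega> in M. \<forall>i. 1 \<le> i \<longrightarrow> 0 < b i \<omega> \<and> b i \<omega> < 1"
    by (subst AE_all_countable) blast
  then have N: "AE \<omega> in M. eventually (\<lambda>n. max_price (empirical_measure n (\<lambda>i. b i \<omega>)) p) sequentially"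
  proof eventually_elim
    case (elim \<omega>)
    show ?case using eventually_ge_at_top[of 1]
      by eventually_elim (use elim in \<open>auto intro!: max_price_empirical_measure p\<close>)
  qed
  show ?thesis
  proof (cases "t = 0")
    case True
    have "AE \<omega> in M. (\<lambda>n. \<integral>x. indicat_real {..y} x \<partial>empirical_measure n (\<lambda>i. b i \<omega>))
        \<longlonglongrightarrow> (\<integral>x. indicat_real {..y} x \<partial>\<mu>)" for y :: real
      by (rule AE_empirical_integral_tendsto[OF indep law, of _ 0 1]) (auto simp: indicator_def)
    then have "AE \<omega> in M. \<forall>y\<in>\<rat>. (\<lambda>n. cdf (empirical_measure n (\<lambda>i. b i \<omega>)) y) \<longlonglongrightarrow> cdf \<mu> y"
      by (intro AE_ball_countable[THEN iffD2] ballI countable_rat) (simp add: cdf_def \<mu>(1))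
    with N show ?thesis
    proof eventually_elim
      case (elim \<omega>)
      let ?N = "\<lambda>n. empirical_measure n (\<lambda>i. b i \<omega>)"
      have "(\<lambda>n. quantile (?N n) p) \<longlonglongrightarrow> quantile \<mu> p"
        using elim level True by (intro quantile_tendsto mp) auto
      then have "(\<lambda>n. quantile (?N n) p) \<longlonglongrightarrow> max_price_evolution p \<mu> t"
        unfolding True max_price.max_price_evolution_0[OF mp] .
      then show ?case
      proof (rule Lim_transform_eventually)
        show "\<forall>\<^sub>F n in sequentially. quantile (?N n) p = max_price_evolution p (?N n) t"
          using elim(1) unfolding True by eventually_elim (simp add: max_price.max_price_evolution_0)
      qed
    qed
  next
    case False
    with t have t0: "0 < t" by simp
    have "AE \<omega> in M. (\<lambda>n. \<integral>x. max 0 (y + t - x) - max 0 (y - t - x) \<partial>empirical_measure n (\<lambda>i. b i \<omega>))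
        \<longlonglongrightarrow> (\<integral>x. max 0 (y + t - x) - max 0 (y - t - x) \<partial>\<mu>)" for y :: real
      by (rule AE_empirical_integral_tendsto[OF indep law, of _ 0 "2 * t"]) (use t0 in auto)
    \<comment> \<open>The exceptional null set depends on \<open>y\<close>; restricting to rationals
      keeps their union null.\<close>
    then have "AE \<omega> in M. \<forall>y\<in>\<rat>. (\<lambda>n. \<integral>x. max 0 (y + t - x) - max 0 (y - t - x) \<partial>empirical_measure n (\<lambda>i. b i \<omega>))
        \<longlonglongrightarrow> (\<integral>x. max 0 (y + t - x) - max 0 (y - t - x) \<partial>\<mu>)"
      by (intro AE_ball_countable[THEN iffD2] ballI countable_rat)
    with N show ?thesis
    proof eventually_elim
      case (elim \<omega>)
      let ?N = "\<lambda>n. empirical_measure n (\<lambda>i. b i \<omega>)"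
      have "(\<lambda>n. max_price.free_price (?N n) p t) \<longlonglongrightarrow> max_price.free_price \<mu> p t"
        using elim(2) by (intro free_price_tendsto mp elim(1) t0 level) auto
      then have "(\<lambda>n. min 1 (max 0 (max_price.free_price (?N n) p t))) \<longlonglongrightarrow> max_price_evolution p \<mu> t"
        unfolding max_price.max_price_evolution_eq[OF mp t] by (intro tendsto_intros)
      then show ?case
      proof (rule Lim_transform_eventually)
        show "\<forall>\<^sub>F n in sequentially. min 1 (max 0 (max_price.free_price (?N n) p t)) = max_price_evolution p (?N n) t"
          using elim(1) by eventually_elim (simp add: max_price.max_price_evolution_eq t)
      qed
    qed
  qed
qed

end
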